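(* Let $\{\mu_\theta:\theta\in\Theta\}\subseteq\mathscr{P}(\mathbb{R}^d)$ be a statistical model with $\Theta\subseteq\mathbb{R}^{d_\theta}$, let $\mu_\star\in\mathscr{P}(\mathbb{R}^d)$ be the data-generating distribution (not necessarily in the model), let $\widehat{\mu}_n$ be the empirical measure of the data, and let $\theta_\star$ be a point in the interior of $\Theta$ that minimizes $\theta\mapsto\overline{\mathcal{PW}}_{1,1}(\mu_\star,\mu_\theta)$ over $\Theta$. Assume: (1) $\lim_{n\to+\infty}\mathcal{W}_1(\widehat{\mu}_n,\mu_\star)=0$ almost surely; (2) $\|\theta_n-\theta\|_\Theta\to0$ implies $\mu_{\theta_n}\Rightarrow\mu_\theta$; (3) there exists $\tau>0$ such that $\{\theta\in\Theta:\overline{\mathcal{PW}}_{1,1}(\mu_\star,\mu_\theta)\le\inf_{\theta'\in\Theta}\overline{\mathcal{PW}}_{1,1}(\mu_\star,\mu_{\theta'})+\tau\}$ is bounded; (4) there exists a measurable function $D_\star:\mathbb{S}^{d-1}\times\mathbb{R}\to\mathbb{R}^{d_\theta}$ such that $\|F_\theta-F_{\theta_\star}-\langle\theta-\theta_\star,D_\star\rangle\|_L=o(\|\theta-\theta_\star\|_\Theta)$; (5) there exists a random element $G_\star:\mathbb{S}^{d-1}\times\mathbb{R}\to\mathbb{R}$ such that the stochastic process $\sqrt n(\widehat{F}_n-F_\star)$ converges weakly in $L(\mathbb{S}^{d-1}\times\mathbb{R})$ to $G_\star$; (6) there exist a neighborhood $\mathcal{N}$ of $\theta_\star$ in $\Theta$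 and a constant $c_\star>0$ such that $\overline{\mathcal{PW}}_{1,1}(\mu_\theta,\mu_\star)\ge\overline{\mathcal{PW}}_{1,1}(\mu_{\theta_\star},\mu_\star)+c_\star\|\theta-\theta_\star\|_\Theta$ for all $\theta\in\mathcal{N}$. Let $G_n=\sqrt n(\widehat{F}_n-F_{\theta_\star})$ and $G_n^\star=G_\star+\sqrt n(F_\star-F_{\theta_\star})$. Define $$\mathcal{N}_1=\left\{\theta\in\mathcal{N}:\frac{\|F_\theta-F_{\theta_\star}-\langle\theta-\theta_\star,D_\star\rangle\|_L}{\|\theta-\theta_\star\|_\Theta}\le\frac{c_\star}{2}\right\}$$ (with $\theta_\star\in\mathcal{N}_1$ by convention) and, for a function $x$ on $\mathbb{S}^{d-1}\times\mathbb{R}$ and $\beta\ge0$, $$K(x,\beta)=\left\{\theta\in\mathcal{N}_1:\|x-\sqrt n\langle\theta-\theta_\star,D_\star\rangle\|_L\le\inf_{\theta'\in\mathcal{N}_1}\|x-\sqrt n\langle\theta'-\theta_\star,D_\star\rangle\|_L+\beta\right\},$$ where the $n$ in $K$ is that of its argument $x=G_n$ or $x=G_n^\star$. Then there exists a sequence $\beta_n$ with $\lim_{n\to+\infty}\beta_n=0$ such that $$\mathbb{P}_\star\left(M_n\subseteq K(G_n,\beta_n)\right)\to1\quad\text{as }n\to+\infty,$$ and, for any $\epsilon>0$, $$\mathbb{P}\left(d_H(K(G_n^\star,0),K(G_n,\beta_n))<\epsilon\right)\to1\quad\text{as }n\to+\infty.$$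
   Context: $\|\cdot\|$ is the Euclidean norm, $\Rightarrow$ denotes weak convergence, $\mathscr{P}(\mathbb{R}^d)$ is the set of Borel probability measures on $\mathbb{R}^d$, $\mathbb{S}^{d-1}$ is the unit sphere of $\mathbb{R}^d$. $\mathcal{W}_1$ is the Wasserstein distance of order 1, and $\overline{\mathcal{PW}}_{1,1}(\mu,\nu)=\sup_{u\in\mathbb{S}^{d-1}}\mathcal{W}_1(u^\star_{\#}\mu,u^\star_{\#}\nu)$, where $u^\star_{\#}\mu$ is the push-forward of $\mu$ under $x\mapsto\langle u,x\rangle$. Model: $(\Theta,\|\cdot\|_\Theta)$ is Polish and $\sigma$-compact, and $\mu_\theta=\mu_{\theta'}$ implies $\theta=\theta'$. Data $X_1,X_2,\dots$ are i.i.d. from $\mu_\star$, $\widehat{\mu}_n=\frac1n\sum_{i=1}^n\delta_{X_i}$. For $u\in\mathbb{S}^{d-1}$, $t\in\mathbb{R}$: $F_\theta(u,t)=\int_{\mathbb{R}^d}\mathbf{1}_{(-\infty,t]}(\langle u,x\rangle)\,d\mu_\theta(x)$, $F_\star(u,t)=\int_{\mathbb{R}^d}\mathbf{1}_{(-\infty,t]}(\langle u,x\rangle)\,d\mu_\star(x)$, and $\widehat{F}_n(u,t)=\frac1n|\{i\in\{1,\dots,n\}:\langle u,X_i\rangle\le t\}|$. $L(\mathbb{S}^{d-1}\times\mathbb{R})$ is the class of functions $f$ on $\mathbb{S}^{d-1}\times\mathbb{R}$ such that $f(\cdot,t)$ is continuous and $f(u,\cdot)$ is absolutely integrable, with norm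 $\|f\|_L=\sup_{u\in\mathbb{S}^{d-1}}\int_{\mathbb{R}}|f(u,t)|\,dt$. $\langle\theta,D_\star\rangle$ denotes the function $(u,t)\mapsto\langle\theta,D_\star(u,t)\rangle$. Approximate minimum PRW estimators: $M_n=\{\theta\in\Theta:\overline{\mathcal{PW}}_{1,1}(\widehat{\mu}_n,\mu_\theta)\le\inf_{\theta'\in\Theta}\overline{\mathcal{PW}}_{1,1}(\widehat{\mu}_n,\mu_{\theta'})+\eta_n/\sqrt n\}$, where $\eta_n>0$ is such that $\mathbb{P}(\eta_n\to0)=1$ and $M_n$ is nonempty. $\mathbb{P}_\star$ denotes inner probability. The Hausdorff metric is $d_H(S_1,S_2)=\inf\{\delta>0:S_1\subseteq S_2^\delta,\ S_2\subseteq S_1^\delta\}$, where $S^\delta$ is the set of points within distance at most $\delta$ of some point of $S$; here it is applied to subsets of $\Theta$ with the distance induced by $\|\cdot\|_\Theta$. $G_\star$ and the data are regarded as defined on a common probability space.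
   Formalization: The point θ⋆ is assumed to be the unique minimizer of θ ↦ PW(μ⋆, μ_θ) over Θ, not merely a minimizer; with a second minimizer outside the neighborhood N, M_n may contain it while K(G_n, β_n) lies in N, so the first conclusion fails. *)

theory Defs
  imports "HOL-Probability.Probability"
begin

section \<open>Wasserstein and projection robust Wasserstein distances\<close>

definition couplings ::
  "'a::{second_countable_topology, metric_space} measure \<Rightarrow> 'a measure \<Rightarrow> ('a \<times> 'a) measure set" where
  "couplings \<mu> \<nu> =
     {\<pi>. sets \<pi> = sets (borel \<Otimes>\<^sub>M borel) \<and> distr \<pi> borel fst = \<mu> \<and> distr \<pi> borel snd = \<nu>}"

text \<open>The value is \<open>\<infinity>\<close> when no coupling has finite cost, so that measures without a
  first moment are admitted.\<close>

definition wasserstein1 ::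
  "'a::{second_countable_topology, metric_space} measure \<Rightarrow> 'a measure \<Rightarrow> ennreal" where
  "wasserstein1 \<mu> \<nu> = (INF \<pi>\<in>couplings \<mu> \<nu>. \<integral>\<^sup>+ p. ennreal (dist (fst p) (snd p)) \<partial>\<pi>)"

definition PW :: "'a::euclidean_space measure \<Rightarrow> 'a measure \<Rightarrow> ennreal" where
  "PW \<mu> \<nu> = (SUP u\<in>sphere 0 1.
     wasserstein1 (distr \<mu> borel (\<lambda>x. u \<bullet> x)) (distr \<nu> borel (\<lambda>x. u \<bullet> x)))"

definition weakly_converges ::
  "(nat \<Rightarrow> 'a::euclidean_space measure) \<Rightarrow> 'a measure \<Rightarrow> bool" where
  "weakly_converges \<mu>s \<mu> \<longleftrightarrow>
     (\<forall>f :: 'a \<Rightarrow> real. continuous_on UNIV f \<and> bounded (range f) \<longrightarrow>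
        (\<lambda>n. \<integral>x. f x \<partial>\<mu>s n) \<longlonglongrightarrow> (\<integral>x. f x \<partial>\<mu>))"

section \<open>Empirical measure and projected distribution functions\<close>

text \<open>Observations are indexed from 0: the sample of size \<open>n\<close> is \<open>x 0, \<dots>, x (n - 1)\<close>.
  The push-forward below is $\frac1n\sum_{i<n}\delta_{x_i}$ (for \<open>n > 0\<close>).\<close>

definition empirical_measure :: "nat \<Rightarrow> (nat \<Rightarrow> 'a::euclidean_space) \<Rightarrow> 'a measure" where
  "empirical_measure n x = distr (uniform_count_measure {..<n}) borel x"

definition proj_cdf :: "'a::euclidean_space measure \<Rightarrow> 'a \<Rightarrow> real \<Rightarrow> real" where
  "proj_cdf \<mu> u t = (\<integral>x. indicator {..t} (u \<bullet> x) \<partial>\<mu>)"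

definition emp_cdf :: "nat \<Rightarrow> (nat \<Rightarrow> 'a::euclidean_space) \<Rightarrow> 'a \<Rightarrow> real \<Rightarrow> real" where
  "emp_cdf n x u t = real (card {i. i < n \<and> u \<bullet> x i \<le> t}) / real n"

section \<open>The function class on the sphere times the line\<close>

text \<open>Functions on the sphere times the line are represented by functions on the whole space
  times the line; only their values at unit vectors \<open>u\<close> are ever used.\<close>

definition L_norm :: "('a::euclidean_space \<Rightarrow> real \<Rightarrow> real) \<Rightarrow> ennreal" where
  "L_norm f = (SUP u\<in>sphere 0 1. \<integral>\<^sup>+ t. ennreal \<bar>f u t\<bar> \<partial>lebesgue)"

definition L_ambient :: "('a::euclidean_space \<Rightarrow> real \<Rightarrow> real) set" where
  "L_ambient = {f. (\<forall>u\<in>sphere 0 1. f u absolutely_integrable_on UNIV) \<and> L_norm f < \<infinity>}"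

definition L_space :: "('a::euclidean_space \<Rightarrow> real \<Rightarrow> real) set" where
  "L_space = {f \<in> L_ambient. \<forall>t. continuous_on (sphere 0 1) (\<lambda>u. f u t)}"

text \<open>Empirical distribution functions jump in \<open>u\<close>, so the empirical process lies in
  \<open>L_ambient\<close> but not in \<open>L_space\<close>. Weak convergence is therefore tested on the functionals that
  are bounded and continuous for the distance \<open>L_norm (f - g)\<close> on \<open>L_ambient\<close>, the limit taking
  values in \<open>L_space\<close>. Weak convergence does not depend on the ambient space, so for processes
  with values in \<open>L_space\<close> this is weak convergence in \<open>L_space\<close>.\<close>

definition bounded_continuous_functional ::
  "(('a::euclidean_space \<Rightarrow> real \<Rightarrow> real) \<Rightarrow> real) \<Rightarrow> bool" where
  "bounded_continuous_functional h \<longleftrightarrow>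
     bounded (h ` L_ambient) \<and>
     (\<forall>f\<in>L_ambient. \<forall>\<epsilon>>0. \<exists>\<delta>>0. \<forall>g\<in>L_ambient.
        L_norm (\<lambda>u t. g u t - f u t) < ennreal \<delta> \<longrightarrow> \<bar>h g - h f\<bar> < \<epsilon>)"

definition outer_expectation :: "'w measure \<Rightarrow> ('w \<Rightarrow> real) \<Rightarrow> real" where
  "outer_expectation P Y =
     Inf {(\<integral>\<omega>. U \<omega> \<partial>P) | U. integrable P U \<and> (\<forall>\<omega>\<in>space P. Y \<omega> \<le> U \<omega>)}"

definition random_element_L ::
  "'w measure \<Rightarrow> ('w \<Rightarrow> 'a::euclidean_space \<Rightarrow> real \<Rightarrow> real) \<Rightarrow> bool" where
  "random_element_L P G \<longleftrightarrow>
     (\<forall>\<omega>\<in>space P. G \<omega> \<in> L_space) \<and>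
     (\<forall>h. bounded_continuous_functional h \<longrightarrow> (\<lambda>\<omega>. h (G \<omega>)) \<in> borel_measurable P)"

text \<open>Weak convergence in the sense of Hoffmann-Jorgensen: the processes \<open>Z n\<close> need not be
  measurable.\<close>

definition weakly_converges_L ::
  "'w measure \<Rightarrow> (nat \<Rightarrow> 'w \<Rightarrow> 'a::euclidean_space \<Rightarrow> real \<Rightarrow> real)
     \<Rightarrow> ('w \<Rightarrow> 'a \<Rightarrow> real \<Rightarrow> real) \<Rightarrow> bool" where
  "weakly_converges_L P Z G \<longleftrightarrow>
     (\<forall>h. bounded_continuous_functional h \<longrightarrow>
        (\<lambda>n. outer_expectation P (\<lambda>\<omega>. h (Z n \<omega>))) \<longlonglongrightarrow> (\<integral>\<omega>. h (G \<omega>) \<partial>P))"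

definition inner_prob :: "'w measure \<Rightarrow> 'w set \<Rightarrow> real" where
  "inner_prob P A = (SUP B\<in>{B \<in> sets P. B \<subseteq> A}. measure P B)"

section \<open>The parameter space\<close>

definition is_norm :: "('b::real_vector \<Rightarrow> real) \<Rightarrow> bool" where
  "is_norm N \<longleftrightarrow>
     (\<forall>x. 0 \<le> N x) \<and> (\<forall>x. N x = 0 \<longleftrightarrow> x = 0) \<and>
     (\<forall>a x. N (a *\<^sub>R x) = \<bar>a\<bar> * N x) \<and> (\<forall>x y. N (x + y) \<le> N x + N y)"

text \<open>As in the type class \<open>polish_space\<close>, Polish means that the given metric itself is
  complete (and the topology second countable).\<close>

definition polish_metric :: "'b set \<Rightarrow> ('b \<Rightarrow> 'b \<Rightarrow> real) \<Rightarrow> bool" where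
  "polish_metric S d \<longleftrightarrow>
     Metric_space S d \<and> Metric_space.mcomplete S d \<and>
     second_countable (Metric_space.mtopology S d)"

definition sigma_compact_metric :: "'b set \<Rightarrow> ('b \<Rightarrow> 'b \<Rightarrow> real) \<Rightarrow> bool" where
  "sigma_compact_metric S d \<longleftrightarrow>
     (\<exists>C :: nat \<Rightarrow> 'b set. (\<forall>k. compactin (Metric_space.mtopology S d) (C k)) \<and> S = (\<Union>k. C k))"

definition hausdorff_metric :: "('b \<Rightarrow> 'b \<Rightarrow> real) \<Rightarrow> 'b set \<Rightarrow> 'b set \<Rightarrow> ennreal" where
  "hausdorff_metric d S T =
     (INF \<delta>\<in>{\<delta>. 0 < \<delta> \<and> (\<forall>x\<in>S. \<exists>y\<in>T. d x y \<le> \<delta>) \<and> (\<forall>y\<in>T. \<exists>x\<in>S. d y x \<le> \<delta>)}. ennreal \<delta>)"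

section \<open>Approximate minimizers\<close>

definition approx_minimizers ::
  "'b set \<Rightarrow> ('b \<Rightarrow> 'a::euclidean_space measure) \<Rightarrow> 'a measure \<Rightarrow> real \<Rightarrow> 'b set" where
  "approx_minimizers \<Theta> \<mu> \<nu> s =
     {\<theta>\<in>\<Theta>. PW \<nu> (\<mu> \<theta>) \<le> (INF \<theta>'\<in>\<Theta>. PW \<nu> (\<mu> \<theta>')) + ennreal s}"

definition linearization_error ::
  "('b::euclidean_space \<Rightarrow> 'a::euclidean_space measure) \<Rightarrow> 'b \<Rightarrow> ('a \<Rightarrow> real \<Rightarrow> 'b) \<Rightarrow> 'b \<Rightarrow> ennreal" where
  "linearization_error \<mu> \<theta>s D \<theta> =
     L_norm (\<lambda>u t. proj_cdf (\<mu> \<theta>) u t - proj_cdf (\<mu> \<theta>s) u t - (\<theta> - \<theta>s) \<bullet> D u t)"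

definition N1_set ::
  "('b::euclidean_space \<Rightarrow> real) \<Rightarrow> ('b \<Rightarrow> 'a::euclidean_space measure) \<Rightarrow> 'b
     \<Rightarrow> ('a \<Rightarrow> real \<Rightarrow> 'b) \<Rightarrow> 'b set \<Rightarrow> real \<Rightarrow> 'b set" where
  "N1_set nrm \<mu> \<theta>s D N c =
     {\<theta>\<in>N. \<theta> = \<theta>s \<or> linearization_error \<mu> \<theta>s D \<theta> / ennreal (nrm (\<theta> - \<theta>s)) \<le> ennreal (c / 2)}"

definition K_set ::
  "'b::euclidean_space set \<Rightarrow> 'b \<Rightarrow> ('a::euclidean_space \<Rightarrow> real \<Rightarrow> 'b) \<Rightarrow> nat
     \<Rightarrow> ('a \<Rightarrow> real \<Rightarrow> real) \<Rightarrow> real \<Rightarrow> 'b set" where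
  "K_set N1 \<theta>s D n x \<beta> =
     {\<theta>\<in>N1. L_norm (\<lambda>u t. x u t - sqrt (real n) * ((\<theta> - \<theta>s) \<bullet> D u t))
        \<le> (INF \<theta>'\<in>N1. L_norm (\<lambda>u t. x u t - sqrt (real n) * ((\<theta>' - \<theta>s) \<bullet> D u t))) + ennreal \<beta>}"

end

theory Submission
  imports Defs
begin

text \<open>
  On the line the Wasserstein distance is the \<open>L\<^sup>1\<close> distance of the distribution functions, so
  \<open>PW\<close> is \<open>L_norm\<close> of the difference of the projected distribution functions, and the problem
  becomes a minimum distance problem for a seminorm. Weak convergence makes the empirical process
  tight. On the event that its norm is at most \<open>K\<close>, approximate minimizers are consistent, because
  the gap \<open>PW \<mu>s (\<mu> \<theta>)\<close> is lower semicontinuous with a bounded level set and a unique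
  minimizer; then linear growth at \<open>\<theta>s\<close> confines them to distance \<open>O(K / sqrt n)\<close>, where replacing
  \<open>F \<theta>\<close> by its linearization changes the scaled objective by \<open>o(1)\<close> only. Hence for every fixed
  \<open>b > 0\<close> the inclusion in \<open>K_set\<close> with tolerance \<open>b\<close> holds with inner probability tending to 1, and
  a diagonal argument gives \<open>\<beta> n\<close> tending to 0. Since the Hausdorff distance is not rescaled,
  it is enough for the second claim that both sets are nonempty and contained in a ball
  of radius \<open>O(K / sqrt n)\<close> around \<open>\<theta>s\<close>.
\<close>

section \<open>The one-dimensional Wasserstein distance\<close>

lemma coupling_sets_space:
  assumes "\<pi> \<in> couplings \<mu> \<nu>"
  shows "sets \<pi> = sets (borel \<Otimes>\<^sub>M borel)" "space \<pi> = UNIV"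
    "distr \<pi> borel fst = \<mu>" "distr \<pi> borel snd = \<nu>"
proof -
  show *: "sets \<pi> = sets (borel \<Otimes>\<^sub>M borel)" "distr \<pi> borel fst = \<mu>" "distr \<pi> borel snd = \<nu>"
    using assms by (auto simp: couplings_def)
  show "space \<pi> = UNIV"
    using sets_eq_imp_space_eq[OF *(1)] by (simp add: space_pair_measure)
qed

text \<open>The indicators differ exactly for \<open>t\<close> in the half-open interval from
  \<open>min x y\<close> to \<open>max x y\<close>. Integrated against a coupling, this splits
  transport cost into levels \<open>t\<close>, on which distribution functions can be
  compared.\<close>

lemma nn_integral_abs_indicator_atMost_diff:
  fixes x y :: real
  shows "(\<integral>\<^sup>+ t. ennreal \<bar>indicator {..t} x - indicator {..t} y\<bar> \<partial>lborel) = ennreal \<bar>x - y\<bar>"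
proof -
  have "(\<integral>\<^sup>+ t. ennreal \<bar>indicator {..t} x - indicator {..t} y\<bar> \<partial>lborel)
      = (\<integral>\<^sup>+ t. indicator {min x y..<max x y} t \<partial>lborel)"
    by (intro nn_integral_cong) (auto simp: indicator_def)
  also have "\<dots> = ennreal \<bar>x - y\<bar>"
    by (simp add: max_def min_def)
  finally show ?thesis .
qed

lemma cdf_distr_eq_integral:
  assumes "f \<in> borel_measurable M"
  shows "cdf (distr M borel f) t = (\<integral>x. indicator {..t} (f x) \<partial>M)"
proof -
  have "cdf (distr M borel f) t = (\<integral>x. indicator {..t} x \<partial>distr M borel f)"
    by (simp add: cdf_def)
  also have "\<dots> = (\<integral>x. indicator {..t} (f x) \<partial>M)"
    using assms by (intro integral_distr) auto
  finally show ?thesis .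
qed

text \<open>At a fixed level \<open>t\<close> the difference of the distribution functions is the
  expectation under \<open>\<pi>\<close> of a difference of indicators, hence at most the expected
  absolute difference; Fubini's theorem then adds up the levels to the transport cost.\<close>

lemma nn_integral_cdf_diff_le_coupling:
  assumes \<pi>: "\<pi> \<in> couplings \<mu> \<nu>" and "prob_space (\<mu> :: real measure)"
  shows "(\<integral>\<^sup>+ t. ennreal \<bar>cdf \<mu> t - cdf \<nu> t\<bar> \<partial>lborel)
       \<le> (\<integral>\<^sup>+ p. ennreal (dist (fst p) (snd p)) \<partial>\<pi>)"
proof -
  note [measurable_cong] = coupling_sets_space(1)[OF \<pi>]
  have [simp]: "space \<pi> = UNIV" using coupling_sets_space[OF \<pi>] by simp
  have fs: "fst \<in> measurable \<pi> (borel :: real measure)" "snd \<in> measurable \<pi> (borel :: real measure)"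
    by measurable
  interpret \<mu>: prob_space \<mu> by fact
  \<comment> \<open>\<open>couplings\<close> does not prescribe the total mass; it is inherited from
    the first marginal.\<close>
  have "prob_space \<pi>"
    using \<mu>.emeasure_space_1 coupling_sets_space(3)[OF \<pi>] fs
    by (intro prob_spaceI) (auto simp: emeasure_distr)
  then interpret \<pi>: prob_space \<pi> .
  interpret pair_sigma_finite lborel \<pi> by standard
  have ind: "integrable \<pi> (\<lambda>p. indicator {..t} (fst p) :: real)"
      "integrable \<pi> (\<lambda>p. indicator {..t} (snd p) :: real)" for t
    by (rule \<pi>.integrable_const_bound[where B=1]; simp)+
  have cdf: "cdf \<mu> t = (\<integral>p. indicator {..t} (fst p) \<partial>\<pi>)"
            "cdf \<nu> t = (\<integral>p. indicator {..t} (snd p) \<partial>\<pi>)" for t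
    using coupling_sets_space(3,4)[OF \<pi>] cdf_distr_eq_integral[OF fs(1), of t]
      cdf_distr_eq_integral[OF fs(2), of t] by simp_all
  have "ennreal \<bar>cdf \<mu> t - cdf \<nu> t\<bar>
      \<le> (\<integral>\<^sup>+ p. ennreal \<bar>indicator {..t} (fst p) - indicator {..t} (snd p)\<bar> \<partial>\<pi>)" for t
    unfolding cdf Bochner_Integration.integral_diff[OF ind, symmetric]
    using integral_norm_bound_ennreal[OF Bochner_Integration.integrable_diff[OF ind]] by simp
  then have "(\<integral>\<^sup>+ t. ennreal \<bar>cdf \<mu> t - cdf \<nu> t\<bar> \<partial>lborel)
      \<le> (\<integral>\<^sup>+ t. (\<integral>\<^sup>+ p. ennreal \<bar>indicator {..t} (fst p) - indicator {..t} (snd p)\<bar> \<partial>\<pi>) \<partial>lborel)"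
    by (intro nn_integral_mono)
  also have "\<dots> = (\<integral>\<^sup>+ p. (\<integral>\<^sup>+ t. ennreal \<bar>indicator {..t} (fst p) - indicator {..t} (snd p)\<bar> \<partial>lborel) \<partial>\<pi>)"
    by (rule Fubini'[symmetric]) (simp add: indicator_def case_prod_unfold)
  also have "\<dots> = (\<integral>\<^sup>+ p. ennreal (dist (fst p) (snd p)) \<partial>\<pi>)"
    by (simp add: nn_integral_abs_indicator_atMost_diff dist_real_def)
  finally show ?thesis .
qed

text \<open>The quantile functions, driven by the same uniform variable, form an optimal coupling.\<close>

lemma wasserstein1_real:
  assumes "real_distribution \<mu>" "real_distribution \<nu>"
  shows "wasserstein1 \<mu> \<nu> = (\<integral>\<^sup>+ t. ennreal \<bar>cdf \<mu> t - cdf \<nu> t\<bar> \<partial>lborel)"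
proof (rule antisym)
  interpret \<mu>: cdf_distribution \<mu> using assms by (simp add: cdf_distribution_def)
  interpret \<nu>: cdf_distribution \<nu> using assms by (simp add: cdf_distribution_def)
  let ?\<Omega> = "restrict_space lborel {0<..<1::real}"
  let ?q = "\<lambda>\<omega>. (\<mu>.I \<omega>, \<nu>.I \<omega>)"
  let ?\<pi> = "distr ?\<Omega> (borel \<Otimes>\<^sub>M borel) ?q"
  have restr: "sets ?\<Omega> = sets (restrict_space borel {0<..<1::real})"
    by (simp add: sets_restrict_space)
  have meas [measurable]: "\<mu>.I \<in> borel_measurable ?\<Omega>" "\<nu>.I \<in> borel_measurable ?\<Omega>"
    using \<mu>.measurable_CI \<nu>.measurable_CI by (simp_all add: measurable_cong_sets[OF restr refl])
  have "prob_space ?\<Omega>"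
    by (auto simp add: emeasure_restrict_space space_restrict_space intro!: prob_spaceI)
  then interpret \<Omega>: prob_space ?\<Omega> .
  interpret pair_sigma_finite lborel ?\<Omega> by standard
  have "?\<pi> \<in> couplings \<mu> \<nu>"
    by (auto simp: couplings_def distr_distr comp_def \<mu>.distr_I_eq_M \<nu>.distr_I_eq_M)
  then have "wasserstein1 \<mu> \<nu> \<le> (\<integral>\<^sup>+ p. ennreal (dist (fst p) (snd p)) \<partial>?\<pi>)"
    unfolding wasserstein1_def by (rule INF_lower)
  also have "\<dots> = (\<integral>\<^sup>+ \<omega>. (\<integral>\<^sup>+ t. ennreal \<bar>indicator {..t} (\<mu>.I \<omega>) - indicator {..t} (\<nu>.I \<omega>)\<bar> \<partial>lborel) \<partial>?\<Omega>)"
    by (simp add: nn_integral_distr nn_integral_abs_indicator_atMost_diff dist_real_def)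
  also have "\<dots> = (\<integral>\<^sup>+ t. (\<integral>\<^sup>+ \<omega>. ennreal \<bar>indicator {..t} (\<mu>.I \<omega>) - indicator {..t} (\<nu>.I \<omega>)\<bar> \<partial>?\<Omega>) \<partial>lborel)"
    by (rule Fubini') (simp add: indicator_def case_prod_unfold)
  also have "\<dots> = (\<integral>\<^sup>+ t. ennreal \<bar>cdf \<mu> t - cdf \<nu> t\<bar> \<partial>lborel)"
  proof (intro nn_integral_cong)
    fix t :: real
    have b: "0 \<le> cdf \<mu> t" "cdf \<mu> t \<le> 1" "0 \<le> cdf \<nu> t" "cdf \<nu> t \<le> 1"
      by (simp_all add: \<mu>.cdf_nonneg \<nu>.cdf_nonneg \<mu>.cdf_bounded_prob \<nu>.cdf_bounded_prob)
    have "(\<integral>\<^sup>+ \<omega>. ennreal \<bar>indicator {..t} (\<mu>.I \<omega>) - indicator {..t} (\<nu>.I \<omega>)\<bar> \<partial>?\<Omega>)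
       = (\<integral>\<^sup>+ \<omega>. ennreal \<bar>indicator {..t} (\<mu>.I \<omega>) - indicator {..t} (\<nu>.I \<omega>)\<bar> * indicator {0<..<1} \<omega> \<partial>lborel)"
      by (rule nn_integral_restrict_space) simp
    \<comment> \<open>The quantile function satisfies \<open>\<mu>.I \<omega> \<le> t\<close> iff
      \<open>\<omega> \<le> cdf \<mu> t\<close>, so the indicators differ for
      \<open>\<omega>\<close> between the two values. The point 1 is removed because
      \<open>\<omega>\<close> runs through the open unit interval while \<open>cdf\<close> may reach
      1.\<close>
    also have "\<dots> = (\<integral>\<^sup>+ \<omega>. indicator ({min (cdf \<mu> t) (cdf \<nu> t)<..max (cdf \<mu> t) (cdf \<nu> t)} - {1}) \<omega> \<partial>lborel)"
      using b by (intro nn_integral_cong)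
        (auto simp: indicator_def \<mu>.pseudoinverse[symmetric] \<nu>.pseudoinverse[symmetric] max_def min_def)
    also have "\<dots> = emeasure lborel ({min (cdf \<mu> t) (cdf \<nu> t)<..max (cdf \<mu> t) (cdf \<nu> t)} - {1})"
      by simp
    also have "\<dots> = emeasure lborel {min (cdf \<mu> t) (cdf \<nu> t)<..max (cdf \<mu> t) (cdf \<nu> t)}"
      by (rule emeasure_Diff_null_set) auto
    also have "\<dots> = ennreal \<bar>cdf \<mu> t - cdf \<nu> t\<bar>"
      by (simp add: max_def min_def)
    finally show "(\<integral>\<^sup>+ \<omega>. ennreal \<bar>indicator {..t} (\<mu>.I \<omega>) - indicator {..t} (\<nu>.I \<omega>)\<bar> \<partial>?\<Omega>)
      = ennreal \<bar>cdf \<mu> t - cdf \<nu> t\<bar>" .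
  qed
  finally show "wasserstein1 \<mu> \<nu> \<le> (\<integral>\<^sup>+ t. ennreal \<bar>cdf \<mu> t - cdf \<nu> t\<bar> \<partial>lborel)" .
  show "(\<integral>\<^sup>+ t. ennreal \<bar>cdf \<mu> t - cdf \<nu> t\<bar> \<partial>lborel) \<le> wasserstein1 \<mu> \<nu>"
    unfolding wasserstein1_def
    by (intro INF_greatest nn_integral_cdf_diff_le_coupling \<mu>.prob_space_axioms)
qed

section \<open>Projected distribution functions and empirical measures\<close>

lemma proj_cdf_eq_cdf:
  assumes "sets \<mu> = sets borel"
  shows "proj_cdf \<mu> u t = cdf (distr \<mu> borel ((\<bullet>) u)) t"
proof -
  note [measurable_cong] = assms
  have "(\<lambda>x. u \<bullet> x) \<in> borel_measurable \<mu>" by measurable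
  from cdf_distr_eq_integral[OF this] show ?thesis by (simp add: proj_cdf_def)
qed

lemma real_distribution_proj:
  fixes u :: "'a::euclidean_space"
  assumes "prob_space \<mu>" "sets \<mu> = sets borel"
  shows "real_distribution (distr \<mu> borel ((\<bullet>) u))"
proof -
  note [measurable_cong] = assms(2)
  interpret prob_space \<mu> by fact
  have "(\<lambda>x. u \<bullet> x) \<in> borel_measurable \<mu>" by measurable
  then show ?thesis by (rule real_distribution_distr)
qed

text \<open>Both sides are suprema over the same directions, so the formula on the line applies
  direction by direction; passing from \<open>lborel\<close> to its completion
  \<open>lebesgue\<close> leaves the integrals unchanged.\<close>

lemma PW_eq_L_norm:
  assumes "prob_space \<mu>" "sets \<mu> = sets borel" "prob_space \<nu>" "sets \<nu> = sets borel"
  shows "PW \<mu> \<nu> = L_norm (\<lambda>u t. proj_cdf \<mu> u t - proj_cdf \<nu> u t)"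
  unfolding PW_def L_norm_def nn_integral_completion
  using assms by (simp add: proj_cdf_eq_cdf wasserstein1_real real_distribution_proj)

lemma prob_space_empirical_measure:
  assumes "n > 0"
  shows "prob_space (empirical_measure n x)" "sets (empirical_measure n x) = sets borel"
proof -
  interpret prob_space "uniform_count_measure {..<n}"
    using assms by (intro prob_space_uniform_count_measure) auto
  show "prob_space (empirical_measure n x)"
    unfolding empirical_measure_def by (intro prob_space_distr) (simp add: measurable_def)
qed (simp add: empirical_measure_def)

lemma proj_cdf_empirical_measure:
  assumes "n > 0"
  shows "proj_cdf (empirical_measure n x) = emp_cdf n x"
proof (intro ext)
  fix u t
  have m: "f \<in> measurable (uniform_count_measure {..<n}) borel" for f :: "nat \<Rightarrow> 'b::topological_space"
    by (simp add: measurable_def)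
  have "proj_cdf (empirical_measure n x) u t
      = measure (uniform_count_measure {..<n}) {i. i < n \<and> u \<bullet> x i \<le> t}"
    unfolding proj_cdf_eq_cdf[OF prob_space_empirical_measure(2)[OF assms]]
    unfolding empirical_measure_def cdf_def
    by (subst distr_distr) (auto simp: m measure_distr space_uniform_count_measure intro!: arg_cong2[where f=measure])
  also have "\<dots> = emp_cdf n x u t"
    by (subst measure_uniform_count_measure) (auto simp: emp_cdf_def)
  finally show "proj_cdf (empirical_measure n x) u t = emp_cdf n x u t" .
qed

section \<open>The norm on functions on the sphere times the line\<close>

text \<open>Subadditivity of \<open>L_norm\<close> needs measurability.\<close>

definition sphere_measurable :: "('a::euclidean_space \<Rightarrow> real \<Rightarrow> real) \<Rightarrow> bool" where
  "sphere_measurable f \<longleftrightarrow> (\<forall>u\<in>sphere 0 1. f u \<in> borel_measurable lebesgue)"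

lemma sphere_measurable_proj_cdf:
  assumes "prob_space \<mu>" "sets \<mu> = sets borel"
  shows "sphere_measurable (proj_cdf \<mu>)"
  unfolding sphere_measurable_def
proof
  fix u :: 'a
  interpret real_distribution "distr \<mu> borel ((\<bullet>) u)"
    by (rule real_distribution_proj[OF assms])
  have "proj_cdf \<mu> u = cdf (distr \<mu> borel ((\<bullet>) u))"
    using proj_cdf_eq_cdf[OF assms(2)] by blast
  moreover have "\<dots> \<in> borel_measurable borel"
    by (intro borel_measurable_mono monoI cdf_nondecreasing)
  ultimately show "proj_cdf \<mu> u \<in> borel_measurable lebesgue"
    by (simp add: measurable_completion)
qed

lemma sphere_measurable_L_ambient: "f \<in> L_ambient \<Longrightarrow> sphere_measurable f"
  by (auto simp: sphere_measurable_def L_ambient_def absolutely_integrable_on_def set_integrable_def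
      absolutely_integrable_measurable)

lemma sphere_measurable_add:
  "sphere_measurable f \<Longrightarrow> sphere_measurable g \<Longrightarrow> sphere_measurable (\<lambda>u t. f u t + g u t)"
  unfolding sphere_measurable_def by (intro ballI borel_measurable_add) blast+

lemma sphere_measurable_diff:
  "sphere_measurable f \<Longrightarrow> sphere_measurable g \<Longrightarrow> sphere_measurable (\<lambda>u t. f u t - g u t)"
  unfolding sphere_measurable_def by (intro ballI borel_measurable_diff) blast+

lemma sphere_measurable_mult:
  "sphere_measurable f \<Longrightarrow> sphere_measurable (\<lambda>u t. a * f u t)"
  unfolding sphere_measurable_def by (intro ballI borel_measurable_times borel_measurable_const) blast

lemmas sphere_measurable_intros =
  sphere_measurable_add sphere_measurable_diff sphere_measurable_mult

lemma sphere_measurable_inner: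
  fixes D :: "'a::euclidean_space \<Rightarrow> real \<Rightarrow> 'b::euclidean_space"
  assumes "(\<lambda>(u, t). D u t) \<in> borel_measurable (restrict_space borel (sphere 0 1) \<Otimes>\<^sub>M borel)"
  shows "sphere_measurable (\<lambda>u t. a \<bullet> D u t)"
  unfolding sphere_measurable_def
proof
  fix u :: 'a assume u: "u \<in> sphere 0 1"
  have "Pair u \<in> measurable borel (restrict_space borel (sphere 0 1) \<Otimes>\<^sub>M borel)"
    using u by (intro measurable_Pair1') (simp add: space_restrict_space)
  from measurable_compose[OF this assms]
  have [measurable]: "D u \<in> borel_measurable borel" by simp
  have "(\<lambda>t. a \<bullet> D u t) \<in> borel_measurable borel" by measurable
  then have "(\<lambda>t. a \<bullet> D u t) \<in> borel_measurable lborel" by simp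
  then show "(\<lambda>t. a \<bullet> D u t) \<in> borel_measurable lebesgue"
    by (rule measurable_completion)
qed

lemma L_norm_cong_abs:
  assumes "\<And>u t. \<bar>f u t\<bar> = \<bar>g u t\<bar>"
  shows "L_norm f = L_norm g"
  using assms by (simp add: L_norm_def)

lemma L_norm_zero [simp]: "L_norm (\<lambda>u t. 0) = 0"
  by (simp add: L_norm_def SUP_constant bot_ennreal)

lemma L_norm_minus_commute: "L_norm (\<lambda>u t. f u t - g u t) = L_norm (\<lambda>u t. g u t - f u t)"
  by (rule L_norm_cong_abs) auto

lemma L_norm_mult: "L_norm (\<lambda>u t. a * f u t) = ennreal \<bar>a\<bar> * L_norm f" if "sphere_measurable f"
proof -
  have "(\<integral>\<^sup>+ t. ennreal \<bar>a * f u t\<bar> \<partial>lebesgue) = ennreal \<bar>a\<bar> * (\<integral>\<^sup>+ t. ennreal \<bar>f u t\<bar> \<partial>lebesgue)"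
    if "u \<in> sphere 0 1" for u
  proof -
    have [measurable]: "f u \<in> borel_measurable lebesgue"
      using \<open>sphere_measurable f\<close> that unfolding sphere_measurable_def by blast
    show ?thesis by (simp add: abs_mult ennreal_mult nn_integral_cmult)
  qed
  then show ?thesis unfolding L_norm_def SUP_mult_left_ennreal by (rule SUP_cong[OF refl])
qed

lemma L_norm_triangle:
  assumes "sphere_measurable f" "sphere_measurable g"
  shows "L_norm (\<lambda>u t. f u t + g u t) \<le> L_norm f + L_norm g"
  unfolding L_norm_def
proof (rule SUP_least)
  fix u :: 'a assume u: "u \<in> sphere 0 1"
  have "(\<integral>\<^sup>+ t. ennreal \<bar>f u t + g u t\<bar> \<partial>lebesgue)
      \<le> (\<integral>\<^sup>+ t. ennreal \<bar>f u t\<bar> + ennreal \<bar>g u t\<bar> \<partial>lebesgue)"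
    by (intro nn_integral_mono) (simp flip: ennreal_plus)
  also have "\<dots> = (\<integral>\<^sup>+ t. ennreal \<bar>f u t\<bar> \<partial>lebesgue) + (\<integral>\<^sup>+ t. ennreal \<bar>g u t\<bar> \<partial>lebesgue)"
    using assms u unfolding sphere_measurable_def
    by (intro nn_integral_add measurable_compose[OF _ measurable_ennreal] borel_measurable_abs) blast+
  also have "\<dots> \<le> (SUP u\<in>sphere 0 1. \<integral>\<^sup>+ t. ennreal \<bar>f u t\<bar> \<partial>lebesgue)
      + (SUP u\<in>sphere 0 1. \<integral>\<^sup>+ t. ennreal \<bar>g u t\<bar> \<partial>lebesgue)"
    using u by (intro add_mono SUP_upper)
  finally show "(\<integral>\<^sup>+ t. ennreal \<bar>f u t + g u t\<bar> \<partial>lebesgue) \<le> \<dots>" .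
qed

text \<open>The decomposition enters as a pointwise identity, so that each later use reduces to an
  algebraic rearrangement.\<close>

lemma L_norm_triangle_via:
  assumes "sphere_measurable f" "sphere_measurable g" "\<And>u t. h u t = f u t + g u t"
  shows "L_norm h \<le> L_norm f + L_norm g"
proof -
  have "h = (\<lambda>u t. f u t + g u t)" using assms(3) by blast
  then show ?thesis using L_norm_triangle[OF assms(1,2)] by simp
qed

text \<open>Fatou's lemma in each direction, then the supremum over directions. The exceptional null
  set of levels may depend on \<open>u\<close>.\<close>

lemma L_norm_le_liminf:
  assumes "\<And>k. sphere_measurable (fk k)"
    and "\<And>u. u \<in> sphere 0 1 \<Longrightarrow> AE t in lebesgue. (\<lambda>k. fk k u t) \<longlonglongrightarrow> f u t"
  shows "L_norm f \<le> liminf (\<lambda>k. L_norm (fk k))"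
  unfolding L_norm_def[of f]
proof (rule SUP_least)
  fix u :: 'a assume u: "u \<in> sphere 0 1"
  have "(\<integral>\<^sup>+ t. ennreal \<bar>f u t\<bar> \<partial>lebesgue) = (\<integral>\<^sup>+ t. liminf (\<lambda>k. ennreal \<bar>fk k u t\<bar>) \<partial>lebesgue)"
  proof (rule nn_integral_cong_AE, use assms(2)[OF u] in eventually_elim)
    fix t assume "(\<lambda>k. fk k u t) \<longlonglongrightarrow> f u t"
    then have "(\<lambda>k. ennreal \<bar>fk k u t\<bar>) \<longlonglongrightarrow> ennreal \<bar>f u t\<bar>"
      by (intro tendsto_ennrealI tendsto_rabs)
    then show "ennreal \<bar>f u t\<bar> = liminf (\<lambda>k. ennreal \<bar>fk k u t\<bar>)"
      by (metis lim_imp_Liminf sequentially_bot)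
  qed
  also have "\<dots> \<le> liminf (\<lambda>k. \<integral>\<^sup>+ t. ennreal \<bar>fk k u t\<bar> \<partial>lebesgue)"
    using assms(1) u unfolding sphere_measurable_def
    by (intro nn_integral_liminf measurable_compose[OF _ measurable_ennreal] borel_measurable_abs) blast
  also have "\<dots> \<le> liminf (\<lambda>k. L_norm (fk k))"
    unfolding L_norm_def using u by (intro Liminf_mono always_eventually allI SUP_upper)
  finally show "(\<integral>\<^sup>+ t. ennreal \<bar>f u t\<bar> \<partial>lebesgue) \<le> \<dots>" .
qed

text \<open>The ramps \<open>cts_step\<close> suffice to test weak convergence on the line, and
  composed with a projection they are bounded continuous functions on the whole space.\<close>

lemma weakly_converges_imp_weak_conv_m_proj:
  assumes "weakly_converges \<mu>k \<mu>" "prob_space \<mu>" "sets \<mu> = sets borel"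
    and "\<And>k. prob_space (\<mu>k k)" "\<And>k. sets (\<mu>k k) = sets borel"
  shows "weak_conv_m (\<lambda>k. distr (\<mu>k k) borel ((\<bullet>) u)) (distr \<mu> borel ((\<bullet>) u))"
proof (rule integral_cts_step_conv_imp_weak_conv)
  note [measurable_cong] = assms(3,5)
  show "real_distribution (distr \<mu> borel ((\<bullet>) u))"
    "\<And>k. real_distribution (distr (\<mu>k k) borel ((\<bullet>) u))"
    using assms by (auto intro: real_distribution_proj)
  fix x y :: real assume "x < y"
  have "uniformly_continuous_on UNIV (cts_step x y)"
    by (rule cts_step_uniformly_continuous) fact
  then have c: "continuous_on UNIV (cts_step x y)" by (rule uniformly_continuous_imp_continuous)
  have [measurable]: "cts_step x y \<in> borel_measurable borel"
    by (rule borel_measurable_continuous_onI[OF c])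
  have "continuous_on UNIV (\<lambda>z. cts_step x y (u \<bullet> z))"
    by (rule continuous_on_compose2[OF c]) (auto intro: continuous_intros)
  moreover have "bounded (range (\<lambda>z. cts_step x y (u \<bullet> z)))"
    by (auto simp: bounded_iff cts_step_def intro!: exI[of _ 1] divide_le_eq_1_pos)
  ultimately have "(\<lambda>k. \<integral>z. cts_step x y (u \<bullet> z) \<partial>\<mu>k k) \<longlonglongrightarrow> (\<integral>z. cts_step x y (u \<bullet> z) \<partial>\<mu>)"
    using assms(1) unfolding weakly_converges_def by blast
  then show "(\<lambda>k. integral\<^sup>L (distr (\<mu>k k) borel ((\<bullet>) u)) (cts_step x y))
     \<longlonglongrightarrow> integral\<^sup>L (distr \<mu> borel ((\<bullet>) u)) (cts_step x y)"
    by (simp add: integral_distr)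
qed

text \<open>Distribution functions converge off the countable set of atoms of the limit, so Fatou's
  lemma applies.\<close>

lemma L_norm_proj_cdf_le_liminf:
  assumes "weakly_converges \<mu>k \<mu>" "prob_space \<mu>" "sets \<mu> = sets borel"
    and "\<And>k. prob_space (\<mu>k k)" "\<And>k. sets (\<mu>k k) = sets borel"
    and "sphere_measurable f"
  shows "L_norm (\<lambda>u t. f u t - proj_cdf \<mu> u t) \<le> liminf (\<lambda>k. L_norm (\<lambda>u t. f u t - proj_cdf (\<mu>k k) u t))"
proof (rule L_norm_le_liminf)
  show "sphere_measurable (\<lambda>u t. f u t - proj_cdf (\<mu>k k) u t)" for k
    using assms by (intro sphere_measurable_intros sphere_measurable_proj_cdf) auto
  fix u :: 'a
  let ?N = "distr \<mu> borel ((\<bullet>) u)"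
  interpret real_distribution ?N using assms by (intro real_distribution_proj)
  have "countable {t. \<not> isCont (cdf ?N) t}"
    using mono_ctble_discont[of "cdf ?N"] by (simp add: monoI cdf_nondecreasing)
  then have "{t. \<not> isCont (cdf ?N) t} \<in> null_sets lborel"
    by (rule countable_imp_null_set_lborel)
  then have "AE t in lborel. isCont (cdf ?N) t"
    by (rule AE_I') auto
  then have "AE t in lebesgue. isCont (cdf ?N) t"
    by (rule AE_completion)
  then show "AE t in lebesgue. (\<lambda>k. f u t - proj_cdf (\<mu>k k) u t) \<longlonglongrightarrow> f u t - proj_cdf \<mu> u t"
  proof eventually_elim
    fix t assume "isCont (cdf ?N) t"
    then have "(\<lambda>k. proj_cdf (\<mu>k k) u t) \<longlonglongrightarrow> proj_cdf \<mu> u t"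
      using weakly_converges_imp_weak_conv_m_proj[OF assms(1-5)] assms(3,5)
      by (simp add: proj_cdf_eq_cdf weak_conv_m_def weak_conv_def)
    then show "(\<lambda>k. f u t - proj_cdf (\<mu>k k) u t) \<longlonglongrightarrow> f u t - proj_cdf \<mu> u t"
      by (intro tendsto_intros)
  qed
qed

section \<open>Norms on Euclidean space\<close>

lemma is_norm_properties:
  assumes "is_norm N"
  shows "0 \<le> N x" "N x = 0 \<longleftrightarrow> x = 0" "N (a *\<^sub>R x) = \<bar>a\<bar> * N x" "N (x + y) \<le> N x + N y"
    "N (- x) = N x" "N (x - y) = N (y - x)" "N (x - y) \<le> N (x - z) + N (z - y)"
    "N x - N y \<le> N (x - y)"
proof -
  show tri: "N (x + y) \<le> N x + N y" for x y using assms by (simp add: is_norm_def)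
  show "0 \<le> N x" "N x = 0 \<longleftrightarrow> x = 0" "N (a *\<^sub>R x) = \<bar>a\<bar> * N x"
    using assms by (auto simp: is_norm_def)
  show minus: "N (- x) = N x" for x
    using assms[unfolded is_norm_def, THEN conjunct2, THEN conjunct2, THEN conjunct1, rule_format, of "-1" x]
    by simp
  show "N (x - y) = N (y - x)" using minus[of "x - y"] by simp
  show "N (x - y) \<le> N (x - z) + N (z - y)" using tri[of "x - z" "z - y"] by simp
  show "N x - N y \<le> N (x - y)" using tri[of "x - y" y] by simp
qed

text \<open>Expansion in the basis gives the upper constant. It makes \<open>nrm\<close> Lipschitz,
  so \<open>nrm\<close> attains on the compact unit sphere a minimum, which is positive and serves
  as lower constant.\<close>

lemma is_norm_equivalent:
  fixes nrm :: "'b::euclidean_space \<Rightarrow> real"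
  assumes "is_norm nrm"
  obtains m C where "m > 0" "C > 0" "\<And>x. m * norm x \<le> nrm x" "\<And>x. nrm x \<le> C * norm x"
proof -
  note N = is_norm_properties[OF assms]
  define C where "C = (\<Sum>b\<in>Basis. nrm b) + 1"
  have C: "C > 0" unfolding C_def by (simp add: N(1) add_nonneg_pos sum_nonneg)
  have sum: "nrm (\<Sum>b\<in>A. g b) \<le> (\<Sum>b\<in>A. nrm (g b))" if "finite A" for A and g :: "'b \<Rightarrow> 'b"
    using that
  proof (induction A rule: finite_induct)
    case empty then show ?case using N(2)[of 0] by simp
  next
    case (insert x A) then show ?case using N(4)[of "g x" "sum g A"] by simp
  qed
  have upper: "nrm x \<le> C * norm x" for x
  proof -
    have "nrm x = nrm (\<Sum>b\<in>Basis. (x \<bullet> b) *\<^sub>R b)" by (simp add: euclidean_representation)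
    also have "\<dots> \<le> (\<Sum>b\<in>Basis. nrm ((x \<bullet> b) *\<^sub>R b))" by (rule sum) simp
    also have "\<dots> = (\<Sum>b\<in>Basis. \<bar>x \<bullet> b\<bar> * nrm b)" by (simp add: N(3))
    also have "\<dots> \<le> (\<Sum>b\<in>Basis. norm x * nrm b)"
      by (intro sum_mono mult_right_mono N(1) Basis_le_norm)
    also have "\<dots> \<le> C * norm x"
      by (simp add: C_def sum_distrib_left[symmetric] algebra_simps)
    finally show ?thesis .
  qed
  have "\<bar>nrm x - nrm y\<bar> \<le> C * dist x y" for x y
    using N(8)[of x y] N(8)[of y x] N(6)[of x y] upper[of "x - y"] by (simp add: dist_norm)
  then have "C-lipschitz_on UNIV nrm"
    using C by (intro lipschitz_onI) (auto simp: dist_real_def)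
  then have "continuous_on (sphere 0 1) nrm"
    using lipschitz_on_continuous_on continuous_on_subset by blast
  then obtain e where e: "e \<in> sphere 0 1" "\<And>y. y \<in> sphere 0 1 \<Longrightarrow> nrm e \<le> nrm y"
    using continuous_attains_inf[of "sphere (0::'b) 1" nrm] by auto
  have "nrm e > 0" using e(1) N(1)[of e] N(2)[of e] by (auto simp: less_le)
  moreover have "nrm e * norm x \<le> nrm x" for x
  proof (cases "x = 0")
    case False
    then have "nrm e \<le> nrm ((1 / norm x) *\<^sub>R x)" by (intro e(2)) simp
    then show ?thesis using False by (simp only: N(3)) (simp add: field_simps)
  qed (simp add: N(2)[THEN iffD2])
  ultimately show thesis using that C upper by blast
qed

lemma is_norm_tendsto:
  fixes nrm :: "'b::euclidean_space \<Rightarrow> real"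
  assumes "is_norm nrm" "(x \<longlongrightarrow> l) F"
  shows "((\<lambda>n. nrm (x n - l)) \<longlongrightarrow> 0) F"
proof -
  obtain m C where mC: "m > 0" "C > 0" "\<And>x. m * norm x \<le> nrm x" "\<And>x. nrm x \<le> C * norm x"
    using is_norm_equivalent[OF assms(1)] by blast
  show ?thesis
  proof (rule tendsto_sandwich[OF _ _ tendsto_const])
    have "((\<lambda>n. norm (x n - l)) \<longlongrightarrow> 0) F" using assms(2) LIM_zero tendsto_norm_zero by blast
    then show "((\<lambda>n. C * norm (x n - l)) \<longlongrightarrow> 0) F" by (rule tendsto_mult_right_zero)
    show "\<forall>\<^sub>F n in F. 0 \<le> nrm (x n - l)" by (simp add: is_norm_properties(1)[OF assms(1)])
    show "\<forall>\<^sub>F n in F. nrm (x n - l) \<le> C * norm (x n - l)" by (simp add: mC(4))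
  qed
qed

text \<open>Heine-Borel, transferred by the equivalence of norms; it supplies the convergent
  subsequences in both compactness arguments below.\<close>

lemma compact_is_norm_cball:
  fixes nrm :: "'b::euclidean_space \<Rightarrow> real"
  assumes "is_norm nrm"
  shows "compact {x. nrm (x - a) \<le> r}"
  unfolding compact_eq_bounded_closed
proof
  note N = is_norm_properties[OF assms]
  obtain m C where mC: "m > 0" "C > 0" "\<And>x. m * norm x \<le> nrm x" "\<And>x. nrm x \<le> C * norm x"
    using is_norm_equivalent[OF assms(1)] by blast
  have "dist a x \<le> r / m" if "nrm (x - a) \<le> r" for x
    using mC(3)[of "x - a"] that mC(1) by (simp add: dist_norm norm_minus_commute field_simps)
  then show "bounded {x. nrm (x - a) \<le> r}" unfolding bounded_def by blast
  show "closed {x. nrm (x - a) \<le> r}"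
    unfolding closed_sequential_limits
  proof (intro allI impI, elim conjE)
    fix x l assume x: "\<forall>n. x n \<in> {x. nrm (x - a) \<le> r}" "x \<longlonglongrightarrow> l"
    have "nrm (l - a) \<le> 0 + r"
    proof (rule tendsto_lowerbound[OF tendsto_add[OF is_norm_tendsto[OF assms x(2)] tendsto_const]])
      show "\<forall>\<^sub>F n in sequentially. nrm (l - a) \<le> nrm (x n - l) + r"
      proof (intro always_eventually allI)
        fix n
        have "nrm (l - a) \<le> nrm (l - x n) + nrm (x n - a)" by (rule N(7))
        then show "nrm (l - a) \<le> nrm (x n - l) + r" using x(1) N(6)[of l "x n"] by (simp add: add_mono order_trans)
      qed
    qed simp
    then show "l \<in> {x. nrm (x - a) \<le> r}" by simp
  qed
qed

text \<open>A sequence in \<open>S\<close> that converges in the surrounding space is Cauchy for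
  \<open>nrm\<close>; completeness gives it a limit inside \<open>S\<close>, and the two limits
  coincide. Closedness is what turns bounded level sets of parameters into relatively compact
  ones.\<close>

lemma closed_if_polish_metric:
  fixes S :: "'b::euclidean_space set"
  assumes nrm: "is_norm nrm" and polish: "polish_metric S (\<lambda>x y. nrm (x - y))"
  shows "closed S"
  unfolding closed_sequential_limits
proof (intro allI impI, elim conjE)
  fix x l assume x: "\<forall>n. x n \<in> S" "x \<longlonglongrightarrow> l"
  interpret Metric_space S "\<lambda>x y. nrm (x - y)" using polish by (simp add: polish_metric_def)
  note N = is_norm_properties[OF nrm]
  have lim: "(\<lambda>n. nrm (x n - l)) \<longlonglongrightarrow> 0" by (rule is_norm_tendsto[OF nrm x(2)])
  have l: "\<exists>N. \<forall>n\<ge>N. nrm (x n - l) < e" if "e > 0" for e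
    using order_tendstoD(2)[OF lim that] by (simp add: eventually_sequentially)
  have "MCauchy x"
    unfolding MCauchy_def
  proof (intro conjI allI impI)
    show "range x \<subseteq> S" using x by auto
    fix e :: real assume "e > 0"
    with l[of "e / 2"] obtain K where K: "\<And>n. n \<ge> K \<Longrightarrow> nrm (x n - l) < e / 2" by auto
    have "nrm (x n - x n') < e" if "n \<ge> K" "n' \<ge> K" for n n'
      using N(7)[of "x n" "x n'" l] N(6)[of l "x n'"] K[OF that(1)] K[OF that(2)] by linarith
    then show "\<exists>K. \<forall>n n'. K \<le> n \<longrightarrow> K \<le> n' \<longrightarrow> nrm (x n - x n') < e" by blast
  qed
  moreover have mcomplete using polish by (simp add: polish_metric_def)
  ultimately obtain a where "limitin mtopology x a sequentially" by (auto simp: mcomplete_def)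
  then have a: "a \<in> S" "\<And>e. e > 0 \<Longrightarrow> \<exists>N. \<forall>n\<ge>N. nrm (x n - a) < e"
    unfolding limit_metric_sequentially by blast+
  have "nrm (l - a) \<le> 0"
  proof (rule field_le_epsilon)
    fix e :: real assume "e > 0"
    then have "e / 2 > 0" by simp
    from l[OF this] a(2)[OF this] obtain K K' where
      "\<And>n. n \<ge> K \<Longrightarrow> nrm (x n - l) < e / 2" "\<And>n. n \<ge> K' \<Longrightarrow> nrm (x n - a) < e / 2"
      by auto
    then have "nrm (x (max K K') - l) < e / 2" "nrm (x (max K K') - a) < e / 2"
      by simp_all
    then show "nrm (l - a) \<le> 0 + e"
      using N(7)[of l a "x (max K K')"] N(6)[of l "x (max K K')"] by linarith
  qed
  then have "l = a" using N(1,2)[of "l - a"] by simp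
  then show "l \<in> S" using a by simp
qed

text \<open>Two points of a ball of radius \<open>r\<close> are at most \<open>2 * r\<close> apart,
  so any fixed point of one set is a partner for every point of the other. Nonemptiness provides
  these partners.\<close>

lemma hausdorff_metric_less:
  assumes nrm: "is_norm nrm" and "S \<noteq> {}" "T \<noteq> {}" and "2 * r < e" "0 < r"
    and S: "\<And>x. x \<in> S \<Longrightarrow> nrm (x - a) \<le> r" and T: "\<And>x. x \<in> T \<Longrightarrow> nrm (x - a) \<le> r"
  shows "hausdorff_metric (\<lambda>x y. nrm (x - y)) S T < ennreal e"
proof -
  note N = is_norm_properties[OF nrm]
  have *: "nrm (x - y) \<le> 2 * r" if "nrm (x - a) \<le> r" "nrm (y - a) \<le> r" for x y
    using N(7)[of x y a] N(6)[of a y] that by simp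
  have "hausdorff_metric (\<lambda>x y. nrm (x - y)) S T \<le> ennreal (2 * r)"
    unfolding hausdorff_metric_def
  proof (intro INF_lower CollectI conjI ballI)
    show "0 < 2 * r" using assms by simp
    obtain x y where "x \<in> S" "y \<in> T" using assms by blast
    then show "\<exists>y\<in>T. nrm (x - y) \<le> 2 * r" if "x \<in> S" for x using that * S T by blast
    show "\<exists>x\<in>S. nrm (y - x) \<le> 2 * r" if "y \<in> T" for y using that * S T \<open>x \<in> S\<close> by blast
  qed
  also have "\<dots> < ennreal e" using assms by (simp add: ennreal_less_iff)
  finally show ?thesis .
qed

section \<open>Inner probability\<close>

context prob_space
begin

lemma inner_prob_less_iff:
  "x < inner_prob M A \<longleftrightarrow> (\<exists>B\<in>sets M. B \<subseteq> A \<and> x < prob B)"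
  unfolding inner_prob_def
  by (subst less_cSUP_iff) (auto intro!: bdd_aboveI[of _ 1])

lemma inner_prob_ge: "B \<in> sets M \<Longrightarrow> B \<subseteq> A \<Longrightarrow> prob B \<le> inner_prob M A"
  unfolding inner_prob_def by (intro cSUP_upper) (auto intro!: bdd_aboveI[of _ 1])

lemma inner_prob_le_1: "inner_prob M A \<le> 1"
  using inner_prob_less_iff[of 1 A] prob_le_1 by (meson not_le)

lemma inner_prob_nonneg: "0 \<le> inner_prob M A"
  using inner_prob_ge[of "{}" A] by simp

lemma inner_prob_mono: "A \<subseteq> B \<Longrightarrow> inner_prob M A \<le> inner_prob M B"
  unfolding inner_prob_def by (intro cSUP_subset_mono) (auto intro!: bdd_aboveI[of _ 1])

text \<open>The union bound for complements, applied to measurable subsets that nearly exhaust the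
  two inner probabilities.\<close>

lemma inner_prob_Int:
  assumes "inner_prob M A > 1 - d" "inner_prob M B > 1 - e"
  shows "inner_prob M (A \<inter> B) > 1 - (d + e)"
proof -
  obtain A' B' where *: "A' \<in> sets M" "A' \<subseteq> A" "1 - d < prob A'" "B' \<in> sets M" "B' \<subseteq> B" "1 - e < prob B'"
    using assms inner_prob_less_iff by meson
  have "prob (A' \<union> B') = prob A' + prob B' - prob (A' \<inter> B')"
    using * by (intro measure_Un3) (auto simp: fmeasurable_eq_sets)
  then have "1 - (d + e) < prob (A' \<inter> B')" using * prob_le_1[of "A' \<union> B'"] by linarith
  also have "\<dots> \<le> inner_prob M (A \<inter> B)" using * by (intro inner_prob_ge) auto
  finally show ?thesis .
qed

lemma inner_prob_tendsto_1_iff: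
  "(\<lambda>n. inner_prob M (A n)) \<longlonglongrightarrow> 1 \<longleftrightarrow> (\<forall>d>0. \<forall>\<^sub>F n in sequentially. inner_prob M (A n) > 1 - d)"
proof safe
  fix d :: real assume "(\<lambda>n. inner_prob M (A n)) \<longlonglongrightarrow> 1" "d > 0"
  then show "\<forall>\<^sub>F n in sequentially. 1 - d < inner_prob M (A n)"
    by (intro order_tendstoD(1)[where y = 1]) auto
next
  assume *: "\<forall>d>0. \<forall>\<^sub>F n in sequentially. inner_prob M (A n) > 1 - d"
  show "(\<lambda>n. inner_prob M (A n)) \<longlonglongrightarrow> 1"
  proof (rule order_tendstoI)
    fix a :: real assume "a < 1"
    then show "\<forall>\<^sub>F n in sequentially. a < inner_prob M (A n)" using *[rule_format, of "1 - a"] by simp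
  next
    fix a :: real assume "1 < a"
    then show "\<forall>\<^sub>F n in sequentially. inner_prob M (A n) < a"
      using inner_prob_le_1 by (intro always_eventually allI) (metis order_le_less_trans)
  qed
qed

text \<open>The function \<open>h\<close> may fail to be measurable, but the event that its
  integrable majorant \<open>U\<close> is below 1 is measurable and contained in the event for
  \<open>h\<close>; Markov's inequality bounds its complement.\<close>

lemma inner_prob_Markov:
  fixes U :: "'a \<Rightarrow> real"
  assumes "integrable M U" "\<And>\<omega>. \<omega> \<in> space M \<Longrightarrow> 0 \<le> h \<omega>" "\<And>\<omega>. \<omega> \<in> space M \<Longrightarrow> h \<omega> \<le> U \<omega>"
  shows "1 - expectation U \<le> inner_prob M {\<omega>\<in>space M. h \<omega> < 1}"
proof -
  have [measurable]: "U \<in> borel_measurable M" using assms by simp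
  have pos: "\<And>\<omega>. \<omega> \<in> space M \<Longrightarrow> 0 \<le> U \<omega>" using assms(2,3) order_trans by blast
  have "prob {\<omega>\<in>space M. 1 \<le> U \<omega>} \<le> expectation U / 1"
    using assms(1) pos by (intro integral_Markov_inequality_measure[where A = "{}"]) auto
  moreover have "prob {\<omega>\<in>space M. \<not> 1 \<le> U \<omega>} = 1 - prob {\<omega>\<in>space M. 1 \<le> U \<omega>}"
    by (intro prob_neg) auto
  moreover have "prob {\<omega>\<in>space M. \<not> 1 \<le> U \<omega>} \<le> inner_prob M {\<omega>\<in>space M. h \<omega> < 1}"
    using assms(3) by (intro inner_prob_ge) (auto simp: not_le intro: le_less_trans)
  ultimately show ?thesis by simp
qed

text \<open>Almost sure convergence makes the indicators of the events converge to 1, and dominated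
  convergence passes to their probabilities.\<close>

lemma inner_prob_AE_tendsto_0:
  fixes Y :: "nat \<Rightarrow> 'a \<Rightarrow> real"
  assumes [measurable]: "\<And>n. Y n \<in> borel_measurable M" and "AE \<omega> in M. (\<lambda>n. Y n \<omega>) \<longlonglongrightarrow> 0"
    and "e > 0"
  shows "(\<lambda>n. inner_prob M {\<omega>\<in>space M. Y n \<omega> < e}) \<longlonglongrightarrow> 1"
proof (rule tendsto_sandwich[OF always_eventually always_eventually _ tendsto_const])
  show "\<forall>n. inner_prob M {\<omega>\<in>space M. Y n \<omega> < e} \<le> 1" by (simp add: inner_prob_le_1)
  show "\<forall>n. (\<integral>\<omega>. indicator {\<omega>\<in>space M. Y n \<omega> < e} \<omega> \<partial>M) \<le> inner_prob M {\<omega>\<in>space M. Y n \<omega> < e}"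
    by (auto intro!: inner_prob_ge)
  have "(\<lambda>n. \<integral>\<omega>. indicator {\<omega>\<in>space M. Y n \<omega> < e} \<omega> \<partial>M) \<longlonglongrightarrow> (\<integral>\<omega>. (1::real) \<partial>M)"
  proof (rule integral_dominated_convergence[where w = "\<lambda>_. 1"])
    show "AE \<omega> in M. (\<lambda>n. indicator {\<omega>\<in>space M. Y n \<omega> < e} \<omega>) \<longlonglongrightarrow> (1::real)"
      using assms(2) AE_space
    proof eventually_elim
      fix \<omega> assume "(\<lambda>n. Y n \<omega>) \<longlonglongrightarrow> 0" "\<omega> \<in> space M"
      then have "\<forall>\<^sub>F n in sequentially. Y n \<omega> < e" using order_tendstoD(2) \<open>e > 0\<close> by blast
      with \<open>\<omega> \<in> space M\<close> have "\<forall>\<^sub>F n in sequentially. (1::real) = indicator {\<omega>\<in>space M. Y n \<omega> < e} \<omega>"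
        by (auto elim: eventually_mono)
      then show "(\<lambda>n. indicator {\<omega>\<in>space M. Y n \<omega> < e} \<omega>) \<longlonglongrightarrow> (1::real)"
        by (rule Lim_transform_eventually[OF tendsto_const])
    qed
  qed auto
  then show "(\<lambda>n. \<integral>\<omega>. indicator {\<omega>\<in>space M. Y n \<omega> < e} \<omega> \<partial>M) \<longlonglongrightarrow> (1::real)"
    by (simp add: prob_space)
qed

end

section \<open>Tightness of weakly convergent processes\<close>

text \<open>A ramp in the norm that rises from 0 at level \<open>K\<close> to 1 at level
  \<open>K + 1\<close>. The value 1 at infinite norm ensures that a value below 1 bounds the norm,
  even for functions outside \<open>L_ambient\<close>.\<close>

definition L_norm_clamp :: "real \<Rightarrow> ('a::euclidean_space \<Rightarrow> real \<Rightarrow> real) \<Rightarrow> real" where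
  "L_norm_clamp K f = (if L_norm f = \<infinity> then 1 else max 0 (min 1 (enn2real (L_norm f) - K)))"

lemma L_norm_clamp_bounds: "0 \<le> L_norm_clamp K f" "L_norm_clamp K f \<le> 1"
  by (auto simp: L_norm_clamp_def)

lemma L_norm_le_if_clamp_less_1:
  assumes "L_norm_clamp K f < 1" "K \<ge> 0"
  shows "L_norm f \<le> ennreal (K + 1)"
proof -
  have fin: "L_norm f \<noteq> \<infinity>" and "enn2real (L_norm f) - K < 1"
    using assms by (auto simp: L_norm_clamp_def split: if_splits)
  then have "ennreal (enn2real (L_norm f)) \<le> ennreal (K + 1)" by (intro ennreal_leI) simp
  then show ?thesis using fin by (simp add: ennreal_enn2real_if)
qed

text \<open>On \<open>L_ambient\<close> the triangle inequality makes the norm, and therefore the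
  ramp, 1-Lipschitz; so \<open>\<delta> = \<epsilon>\<close> works.\<close>

lemma bounded_continuous_L_norm_clamp: "bounded_continuous_functional (L_norm_clamp K)"
  unfolding bounded_continuous_functional_def
proof (intro conjI ballI allI impI)
  show "bounded (L_norm_clamp K ` L_ambient)"
    by (intro boundedI[of _ 1]) (auto simp: L_norm_clamp_bounds)
  fix f :: "'a \<Rightarrow> real \<Rightarrow> real" and \<epsilon> :: real assume f: "f \<in> L_ambient" and "\<epsilon> > 0"
  show "\<exists>\<delta>>0. \<forall>g\<in>L_ambient. L_norm (\<lambda>u t. g u t - f u t) < ennreal \<delta>
      \<longrightarrow> \<bar>L_norm_clamp K g - L_norm_clamp K f\<bar> < \<epsilon>"
  proof (intro exI[of _ \<epsilon>] conjI ballI impI \<open>\<epsilon> > 0\<close>)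
    fix g :: "'a \<Rightarrow> real \<Rightarrow> real" assume g: "g \<in> L_ambient" and less: "L_norm (\<lambda>u t. g u t - f u t) < ennreal \<epsilon>"
    have fin: "L_norm f \<noteq> \<infinity>" "L_norm g \<noteq> \<infinity>" using f g by (auto simp: L_ambient_def)
    have d_fin: "L_norm (\<lambda>u t. g u t - f u t) \<noteq> \<infinity>"
      using less by (metis ennreal_less_top infinity_ennreal_def less_trans order_less_irrefl)
    define a b d where "a = enn2real (L_norm f)" and "b = enn2real (L_norm g)"
      and "d = enn2real (L_norm (\<lambda>u t. g u t - f u t))"
    then have abd: "L_norm f = ennreal a" "L_norm g = ennreal b" "a \<ge> 0" "b \<ge> 0"
        "L_norm (\<lambda>u t. g u t - f u t) = ennreal d" "d \<ge> 0"
      using fin d_fin by (simp_all add: ennreal_enn2real_if)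
    have m: "sphere_measurable f" "sphere_measurable g"
      using f g by (auto intro: sphere_measurable_L_ambient)
    have "L_norm g \<le> L_norm (\<lambda>u t. g u t - f u t) + L_norm f"
      by (rule L_norm_triangle_via[OF sphere_measurable_diff]) (simp_all add: m)
    then have "b \<le> d + a"
      using abd by (simp flip: ennreal_plus)
    moreover have "L_norm f \<le> L_norm (\<lambda>u t. f u t - g u t) + L_norm g"
      by (rule L_norm_triangle_via[OF sphere_measurable_diff]) (simp_all add: m)
    then have "a \<le> d + b"
      using abd unfolding L_norm_minus_commute[of f g] by (simp flip: ennreal_plus)
    moreover have "d < \<epsilon>" using less abd by (simp add: ennreal_less_iff)
    ultimately show "\<bar>L_norm_clamp K g - L_norm_clamp K f\<bar> < \<epsilon>"
      using abd by (auto simp: L_norm_clamp_def)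
  qed
qed

context prob_space
begin

text \<open>Every path of \<open>G\<close> has finite norm, so its ramp vanishes once the level
  exceeds that norm; the constant 1 dominates.\<close>

lemma expectation_L_norm_clamp_tendsto_0:
  assumes G: "random_element_L M G"
  shows "(\<lambda>k. expectation (\<lambda>\<omega>. L_norm_clamp (real k) (G \<omega>))) \<longlonglongrightarrow> 0"
proof -
  have "(\<lambda>k. expectation (\<lambda>\<omega>. L_norm_clamp (real k) (G \<omega>))) \<longlonglongrightarrow> (\<integral>\<omega>. (0::real) \<partial>M)"
  proof (rule integral_dominated_convergence[where w = "\<lambda>_. 1"])
    show "(\<lambda>\<omega>. L_norm_clamp (real k) (G \<omega>)) \<in> borel_measurable M" for k
      using G bounded_continuous_L_norm_clamp unfolding random_element_L_def by blast
    show "AE \<omega> in M. (\<lambda>k. L_norm_clamp (real k) (G \<omega>)) \<longlonglongrightarrow> 0"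
    proof (rule AE_I2)
      fix \<omega> assume "\<omega> \<in> space M"
      then have fin: "L_norm (G \<omega>) \<noteq> \<infinity>"
        using G by (auto simp: random_element_L_def L_space_def L_ambient_def)
      have "\<forall>\<^sub>F k in sequentially. enn2real (L_norm (G \<omega>)) \<le> real k"
        using eventually_ge_at_top[of "nat \<lceil>enn2real (L_norm (G \<omega>))\<rceil>"]
        by eventually_elim linarith
      then have "\<forall>\<^sub>F k in sequentially. 0 = L_norm_clamp (real k) (G \<omega>)"
        by eventually_elim (use fin in \<open>simp add: L_norm_clamp_def\<close>)
      then show "(\<lambda>k. L_norm_clamp (real k) (G \<omega>)) \<longlonglongrightarrow> 0"
        by (rule Lim_transform_eventually[OF tendsto_const])
    qed
  qed (auto simp: L_norm_clamp_bounds)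
  then show ?thesis by simp
qed

text \<open>Markov's inequality for the ramp at a level where its expectation is below
  \<open>d\<close>; a ramp value below 1 bounds the norm by that level plus 1.\<close>

lemma random_element_L_tight:
  assumes G: "random_element_L M G" and "d > 0"
  shows "\<exists>K>0. inner_prob M {\<omega>\<in>space M. L_norm (G \<omega>) \<le> ennreal K} > 1 - d"
proof -
  obtain k where k: "expectation (\<lambda>\<omega>. L_norm_clamp (real k) (G \<omega>)) < d"
    using order_tendstoD(2)[OF expectation_L_norm_clamp_tendsto_0[OF G] \<open>d > 0\<close>]
      eventually_happens'[OF sequentially_bot] by blast
  have "(\<lambda>\<omega>. L_norm_clamp (real k) (G \<omega>)) \<in> borel_measurable M"
    using G bounded_continuous_L_norm_clamp unfolding random_element_L_def by blast
  then have "integrable M (\<lambda>\<omega>. L_norm_clamp (real k) (G \<omega>))"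
    by (intro integrable_const_bound[of _ 1]) (auto simp: L_norm_clamp_bounds)
  from inner_prob_Markov[OF this L_norm_clamp_bounds(1) order_refl] k
  have "1 - d < inner_prob M {\<omega>\<in>space M. L_norm_clamp (real k) (G \<omega>) < 1}" by simp
  also have "\<dots> \<le> inner_prob M {\<omega>\<in>space M. L_norm (G \<omega>) \<le> ennreal (real k + 1)}"
    by (intro inner_prob_mono) (auto intro: L_norm_le_if_clamp_less_1 simp del: ennreal_plus)
  finally show ?thesis by (intro exI[of _ "real k + 1"]) auto
qed

text \<open>The ramp is an admissible test functional, so weak convergence transfers its small
  expectation from \<open>G\<close> to the outer expectation along \<open>Z n\<close>, for all large
  \<open>n\<close>.\<close>

lemma weakly_converges_L_tight:
  assumes G: "random_element_L M G" and Z: "weakly_converges_L M Z G" and "d > 0"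
  shows "\<exists>K>0. \<forall>\<^sub>F n in sequentially. inner_prob M {\<omega>\<in>space M. L_norm (Z n \<omega>) \<le> ennreal K} > 1 - d"
proof -
  obtain k where k: "expectation (\<lambda>\<omega>. L_norm_clamp (real k) (G \<omega>)) < d"
    using order_tendstoD(2)[OF expectation_L_norm_clamp_tendsto_0[OF G] \<open>d > 0\<close>]
      eventually_happens'[OF sequentially_bot] by blast
  have "(\<lambda>n. outer_expectation M (\<lambda>\<omega>. L_norm_clamp (real k) (Z n \<omega>)))
      \<longlonglongrightarrow> expectation (\<lambda>\<omega>. L_norm_clamp (real k) (G \<omega>))"
    using Z bounded_continuous_L_norm_clamp unfolding weakly_converges_L_def by blast
  from order_tendstoD(2)[OF this k]
  have "\<forall>\<^sub>F n in sequentially. inner_prob M {\<omega>\<in>space M. L_norm (Z n \<omega>) \<le> ennreal (real k + 1)} > 1 - d"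
  proof eventually_elim
    fix n assume "outer_expectation M (\<lambda>\<omega>. L_norm_clamp (real k) (Z n \<omega>)) < d"
    \<comment> \<open>The constant 1 is a majorant, so the infimum that defines the outer
      expectation runs over a nonempty set, and a value below \<open>d\<close> is witnessed by an
      integrable majorant.\<close>
    then have "\<exists>x\<in>{(\<integral>\<omega>. U \<omega> \<partial>M) | U. integrable M U \<and> (\<forall>\<omega>\<in>space M. L_norm_clamp (real k) (Z n \<omega>) \<le> U \<omega>)}. x < d"
      unfolding outer_expectation_def
      by (intro cInf_lessD) (auto simp: L_norm_clamp_bounds intro!: exI[of _ "\<lambda>_. 1"])
    then obtain U where U: "integrable M U" "\<And>\<omega>. \<omega> \<in> space M \<Longrightarrow> L_norm_clamp (real k) (Z n \<omega>) \<le> U \<omega>"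
      and less: "expectation U < d" by auto
    have "1 - d < inner_prob M {\<omega>\<in>space M. L_norm_clamp (real k) (Z n \<omega>) < 1}"
      using inner_prob_Markov[OF U(1) L_norm_clamp_bounds(1) U(2)] less by fastforce
    also have "\<dots> \<le> inner_prob M {\<omega>\<in>space M. L_norm (Z n \<omega>) \<le> ennreal (real k + 1)}"
      by (intro inner_prob_mono) (auto intro: L_norm_le_if_clamp_less_1 simp del: ennreal_plus)
    finally show "1 - d < \<dots>" .
  qed
  then show ?thesis by (intro exI[of _ "real k + 1"]) auto
qed

end

text \<open>Take the infimum of all tolerances \<open>b\<close> with \<open>1 - b < p n b\<close>
  and add \<open>1 / (n + 1)\<close>. Each fixed positive tolerance is eventually admissible, so the
  infima tend to 0.\<close>

lemma diagonal_null_sequence: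
  fixes p :: "nat \<Rightarrow> real \<Rightarrow> real"
  assumes mono: "\<And>n a b. a \<le> b \<Longrightarrow> p n a \<le> p n b"
    and bounds: "\<And>n b. 0 \<le> p n b" "\<And>n b. p n b \<le> 1"
    and lim: "\<And>b. b > 0 \<Longrightarrow> (\<lambda>n. p n b) \<longlonglongrightarrow> 1"
  obtains \<beta> where "\<And>n. \<beta> n \<ge> 0" "\<beta> \<longlonglongrightarrow> 0" "(\<lambda>n. p n (\<beta> n)) \<longlonglongrightarrow> 1"
proof -
  define S where "S n = {b. 0 < b \<and> 1 - b < p n b}" for n
  \<comment> \<open>The tolerance 2 is always admissible because \<open>1 - 2\<close> is
    negative.\<close>
  have S2: "2 \<in> S n" for n using bounds(1)[of n 2] by (simp add: S_def)
  have bdd: "bdd_below (S n)" for n by (intro bdd_belowI[of _ 0]) (simp add: S_def)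
  have Inf0: "0 \<le> Inf (S n)" for n
  proof (rule cInf_greatest)
    show "S n \<noteq> {}" using S2 by blast
  qed (simp add: S_def)
  have "(\<lambda>n. Inf (S n)) \<longlonglongrightarrow> 0"
  proof (rule order_tendstoI)
    fix a :: real assume "a < 0"
    then show "\<forall>\<^sub>F n in sequentially. a < Inf (S n)" using Inf0 by (intro always_eventually allI) (metis order_less_le_trans)
  next
    fix a :: real assume "0 < a"
    then have "\<forall>\<^sub>F n in sequentially. 1 - a / 2 < p n (a / 2)"
      using order_tendstoD(1)[OF lim[of "a / 2"], of "1 - a / 2"] by simp
    then show "\<forall>\<^sub>F n in sequentially. Inf (S n) < a"
    proof eventually_elim
      case (elim n)
      then have "Inf (S n) \<le> a / 2" using \<open>0 < a\<close> by (intro cInf_lower bdd) (simp add: S_def)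
      then show ?case using \<open>0 < a\<close> by simp
    qed
  qed
  from tendsto_add[OF this LIMSEQ_inverse_real_of_nat]
  have lim0: "(\<lambda>n. Inf (S n) + inverse (real (Suc n))) \<longlonglongrightarrow> 0" by simp
  \<comment> \<open>The summand \<open>inverse (real (Suc n))\<close> lifts the choice strictly
    above the infimum, so some admissible \<open>b\<close> lies below it and monotonicity of
    \<open>p n\<close> carries the bound upward.\<close>
  have lower: "1 - (Inf (S n) + inverse (real (Suc n))) \<le> p n (Inf (S n) + inverse (real (Suc n)))" for n
  proof -
    have "Inf (S n) < Inf (S n) + inverse (real (Suc n))" by simp
    then obtain b where b: "b \<in> S n" "b < Inf (S n) + inverse (real (Suc n))"
      using cInf_lessD S2 by (metis empty_iff)
    then show ?thesis using mono[of b "Inf (S n) + inverse (real (Suc n))" n] by (simp add: S_def)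
  qed
  show thesis
  proof (rule that[OF _ lim0])
    show "0 \<le> Inf (S n) + inverse (real (Suc n))" for n using Inf0[of n] by simp
    show "(\<lambda>n. p n (Inf (S n) + inverse (real (Suc n)))) \<longlonglongrightarrow> 1"
    proof (rule tendsto_sandwich[OF always_eventually always_eventually _ tendsto_const])
      show "(\<lambda>n. 1 - (Inf (S n) + inverse (real (Suc n)))) \<longlonglongrightarrow> 1"
        using tendsto_diff[OF tendsto_const lim0, of 1] by (simp only: diff_zero)
    qed (use lower bounds(2) in blast)+
  qed
qed

section \<open>Minimum distance estimation in a linearizable model\<close>

text \<open>The setting contains only the model and the data law. Samples enter below as arbitrary
  sequences or perturbations with a norm bound, so every estimate in it is deterministic.\<close>

locale prw_model =
  fixes \<Theta> :: "'b::euclidean_space set" and nrm :: "'b \<Rightarrow> real"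
    and \<mu> :: "'b \<Rightarrow> 'a::euclidean_space measure" and \<mu>s :: "'a measure" and \<theta>s :: 'b
    and \<tau> c :: real and D :: "'a \<Rightarrow> real \<Rightarrow> 'b" and N :: "'b set"
  assumes is_norm: "is_norm nrm"
    and closed_Theta: "closed \<Theta>"
    and model: "\<And>\<theta>. \<theta> \<in> \<Theta> \<Longrightarrow> prob_space (\<mu> \<theta>)" "\<And>\<theta>. \<theta> \<in> \<Theta> \<Longrightarrow> sets (\<mu> \<theta>) = sets borel"
    and data_law: "prob_space \<mu>s" "sets \<mu>s = sets borel"
    and theta_interior: "\<theta>s \<in> interior \<Theta>"
    and theta_min: "\<And>\<theta>. \<theta> \<in> \<Theta> \<Longrightarrow> PW \<mu>s (\<mu> \<theta>s) \<le> PW \<mu>s (\<mu> \<theta>)"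
    and theta_unique: "\<And>\<theta>. \<theta> \<in> \<Theta> \<Longrightarrow> PW \<mu>s (\<mu> \<theta>) = PW \<mu>s (\<mu> \<theta>s) \<Longrightarrow> \<theta> = \<theta>s"
    and weak_continuity: "\<And>\<theta>n \<theta>. (\<And>n. \<theta>n n \<in> \<Theta>) \<Longrightarrow> \<theta> \<in> \<Theta> \<Longrightarrow> (\<lambda>n. nrm (\<theta>n n - \<theta>)) \<longlonglongrightarrow> 0
               \<Longrightarrow> weakly_converges (\<lambda>n. \<mu> (\<theta>n n)) (\<mu> \<theta>)"
    and tau_pos: "\<tau> > 0"
    and bounded_level_set: "\<exists>B. \<forall>\<theta>\<in>approx_minimizers \<Theta> \<mu> \<mu>s \<tau>. nrm \<theta> \<le> B"
    and D_measurable: "(\<lambda>(u, t). D u t) \<in> borel_measurable (restrict_space borel (sphere 0 1) \<Otimes>\<^sub>M borel)"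
    and differentiable: "((\<lambda>\<theta>. linearization_error \<mu> \<theta>s D \<theta> / ennreal (nrm (\<theta> - \<theta>s))) \<longlongrightarrow> 0)
               (at \<theta>s within \<Theta>)"
    and N_subset: "N \<subseteq> \<Theta>"
    and N_nhd: "\<exists>U. openin (top_of_set \<Theta>) U \<and> \<theta>s \<in> U \<and> U \<subseteq> N"
    and c_pos: "c > 0"
    and growth: "\<And>\<theta>. \<theta> \<in> N \<Longrightarrow> PW (\<mu> \<theta>) \<mu>s \<ge> PW (\<mu> \<theta>s) \<mu>s + ennreal (c * nrm (\<theta> - \<theta>s))"
begin

abbreviation "F \<theta> \<equiv> proj_cdf (\<mu> \<theta>)"
abbreviation "Fs \<equiv> proj_cdf \<mu>s"
abbreviation "N1 \<equiv> N1_set nrm \<mu> \<theta>s D N c"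
abbreviation "lin \<equiv> linearization_error \<mu> \<theta>s D"

definition gap :: "'b \<Rightarrow> ennreal" where
  "gap \<theta> = L_norm (\<lambda>u t. Fs u t - F \<theta> u t)"

definition obj :: "nat \<Rightarrow> ('a \<Rightarrow> real \<Rightarrow> real) \<Rightarrow> 'b \<Rightarrow> ennreal" where
  "obj n x \<theta> = L_norm (\<lambda>u t. x u t - sqrt (real n) * ((\<theta> - \<theta>s) \<bullet> D u t))"

section \<open>The population objective near its minimizer\<close>

lemmas nrm = is_norm_properties[OF is_norm]

lemma theta_in_Theta: "\<theta>s \<in> \<Theta>" using theta_interior interior_subset by blast

lemma nrm_zero [simp]: "nrm 0 = 0" using nrm(2) by simp

lemma measurable_F: "\<theta> \<in> \<Theta> \<Longrightarrow> sphere_measurable (F \<theta>)"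
  using model by (intro sphere_measurable_proj_cdf)

lemma measurable_Fs: "sphere_measurable Fs"
  using data_law by (intro sphere_measurable_proj_cdf)

lemmas measurable_simps = measurable_F measurable_Fs theta_in_Theta sphere_measurable_intros
  sphere_measurable_inner[OF D_measurable]

lemma PW_eq_gap: "\<theta> \<in> \<Theta> \<Longrightarrow> PW \<mu>s (\<mu> \<theta>) = gap \<theta>" "\<theta> \<in> \<Theta> \<Longrightarrow> PW (\<mu> \<theta>) \<mu>s = gap \<theta>"
  unfolding gap_def using model data_law
  by (simp_all add: PW_eq_L_norm L_norm_minus_commute[of "F \<theta>" Fs])

text \<open>If the minimal value were infinite, every parameter would be a minimizer; since
  \<open>\<theta>s\<close> is interior, there is another parameter, against uniqueness.\<close>

lemma gap_finite: "gap \<theta>s \<noteq> \<infinity>"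
proof
  assume inf: "gap \<theta>s = \<infinity>"
  have "\<theta>s islimpt interior \<Theta>"
    using theta_interior by (intro interior_limit_point) simp
  then obtain \<theta> where \<theta>: "\<theta> \<in> interior \<Theta>" "\<theta> \<noteq> \<theta>s" using islimptE[of \<theta>s _ UNIV] by auto
  then have "\<theta> \<in> \<Theta>" using interior_subset by blast
  then have "PW \<mu>s (\<mu> \<theta>) = PW \<mu>s (\<mu> \<theta>s)"
    using theta_min[of \<theta>] inf PW_eq_gap(1)[OF theta_in_Theta] by (simp add: top.extremum_unique)
  then show False using theta_unique \<open>\<theta> \<in> \<Theta>\<close> \<theta>(2) by blast
qed

definition v :: real where "v = enn2real (gap \<theta>s)"

lemma gap_theta: "gap \<theta>s = ennreal v" and v_nonneg: "0 \<le> v"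
  using gap_finite by (simp_all add: v_def ennreal_enn2real_if)

lemma gap_growth: "\<theta> \<in> N \<Longrightarrow> ennreal (v + c * nrm (\<theta> - \<theta>s)) \<le> gap \<theta>"
  using growth[of \<theta>] N_subset theta_in_Theta PW_eq_gap(2) gap_theta v_nonneg c_pos nrm(1)
  by (simp add: subset_iff)

lemma theta_in_N: "\<theta>s \<in> N" using N_nhd by blast

lemma N1_subset: "N1 \<subseteq> N" by (auto simp: N1_set_def)

lemma theta_in_N1: "\<theta>s \<in> N1" using theta_in_N by (simp add: N1_set_def)

lemma lin_theta: "lin \<theta>s = 0" by (simp add: linearization_error_def)

text \<open>Clears the denominator; at \<open>\<theta>s\<close> itself both sides of the resulting
  bound vanish.\<close>

lemma lin_le_if_quotient_le:
  assumes "\<theta> = \<theta>s \<or> lin \<theta> / ennreal (nrm (\<theta> - \<theta>s)) \<le> ennreal e" "e \<ge> 0"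
  shows "lin \<theta> \<le> ennreal (e * nrm (\<theta> - \<theta>s))"
proof (cases "\<theta> = \<theta>s")
  case False
  then have pos: "nrm (\<theta> - \<theta>s) > 0" using nrm(1,2)[of "\<theta> - \<theta>s"] by (simp add: less_le)
  have "lin \<theta> = lin \<theta> / ennreal (nrm (\<theta> - \<theta>s)) * ennreal (nrm (\<theta> - \<theta>s))"
    using pos False nrm(1)[of "\<theta> - \<theta>s"] by (simp add: ennreal_divide_times divide_ennreal)
  also have "\<dots> \<le> ennreal e * ennreal (nrm (\<theta> - \<theta>s))"
    using assms False by (intro mult_right_mono) auto
  finally show ?thesis using assms pos by (simp add: ennreal_mult)
qed (simp add: lin_theta)

lemma lin_N1: "\<theta> \<in> N1 \<Longrightarrow> lin \<theta> \<le> ennreal (c / 2 * nrm (\<theta> - \<theta>s))"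
  using c_pos by (intro lin_le_if_quotient_le) (auto simp: N1_set_def)

text \<open>Differentiability gives the error bound on a Euclidean ball, and interiority of
  \<open>\<theta>s\<close> lets a small ball fit into \<open>N\<close>; norm equivalence then
  provides a ball for \<open>nrm\<close>.\<close>

lemma local_linearization:
  assumes "e > 0"
  obtains r where "r > 0" "\<And>\<theta>. nrm (\<theta> - \<theta>s) \<le> r \<Longrightarrow> \<theta> \<in> N1"
    "\<And>\<theta>. nrm (\<theta> - \<theta>s) \<le> r \<Longrightarrow> lin \<theta> \<le> ennreal (e * nrm (\<theta> - \<theta>s))"
proof -
  obtain m C where mC: "m > 0" "C > 0" "\<And>x. m * norm x \<le> nrm x" "\<And>x. nrm x \<le> C * norm x"
    using is_norm_equivalent[OF is_norm] by blast
  obtain T where T: "open T" "\<Theta> \<inter> T \<subseteq> N" "\<theta>s \<in> T"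
    using N_nhd by (auto simp: openin_open)
  have "open (interior \<Theta> \<inter> T)" using T by auto
  then obtain d1 where d1: "d1 > 0" "ball \<theta>s d1 \<subseteq> interior \<Theta> \<inter> T"
    using theta_interior T(3) openE by (metis IntI)
  \<comment> \<open>The bound \<open>e\<close> is for the claimed error, \<open>c / 2\<close> for
    membership in \<open>N1\<close>.\<close>
  have "0 < ennreal (min e (c / 2))" using assms c_pos by simp
  from order_tendstoD(2)[OF differentiable this] obtain d2 where d2: "d2 > 0"
    "\<And>\<theta>. \<theta> \<in> \<Theta> \<Longrightarrow> \<theta> \<noteq> \<theta>s \<Longrightarrow> dist \<theta> \<theta>s < d2 \<Longrightarrow>
        lin \<theta> / ennreal (nrm (\<theta> - \<theta>s)) < ennreal (min e (c / 2))"
    unfolding eventually_at by auto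
  \<comment> \<open>The factor \<open>m\<close> converts \<open>nrm\<close> into the Euclidean norm,
    and halving makes the distance strictly smaller than \<open>d1\<close> and
    \<open>d2\<close>.\<close>
  define r where "r = m * min d1 d2 / 2"
  have ball: "\<theta> \<in> N" "\<theta> \<noteq> \<theta>s \<Longrightarrow> lin \<theta> / ennreal (nrm (\<theta> - \<theta>s)) \<le> ennreal (min e (c / 2))"
    if "nrm (\<theta> - \<theta>s) \<le> r" for \<theta>
  proof -
    have "m * norm (\<theta> - \<theta>s) < m * min d1 d2"
      using mC(1) mC(3)[of "\<theta> - \<theta>s"] that d1(1) d2(1) unfolding r_def by (smt (verit) mult_pos_pos field_sum_of_halves)
    then have dist: "dist \<theta> \<theta>s < d1" "dist \<theta> \<theta>s < d2" using mC(1) by (simp_all add: dist_norm)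
    then have "\<theta> \<in> interior \<Theta> \<inter> T" using d1(2) by (auto simp: dist_commute)
    then have "\<theta> \<in> \<Theta> \<inter> T" using interior_subset by blast
    then show "\<theta> \<in> N" "\<theta> \<noteq> \<theta>s \<Longrightarrow> lin \<theta> / ennreal (nrm (\<theta> - \<theta>s)) \<le> ennreal (min e (c / 2))"
      using T(2) d2(2)[of \<theta>] dist by (auto intro: less_imp_le)
  qed
  show thesis
  proof (rule that)
    show "r > 0" using mC d1 d2 by (simp add: r_def)
    fix \<theta> assume \<theta>: "nrm (\<theta> - \<theta>s) \<le> r"
    have le: "ennreal (min e (c / 2)) \<le> ennreal (c / 2)" "ennreal (min e (c / 2)) \<le> ennreal e"
      by (auto intro!: ennreal_leI)
    show "\<theta> \<in> N1" using ball[OF \<theta>] order_trans[OF _ le(1)] by (auto simp: N1_set_def)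
    show "lin \<theta> \<le> ennreal (e * nrm (\<theta> - \<theta>s))"
      using ball[OF \<theta>] order_trans[OF _ le(2)] assms by (intro lin_le_if_quotient_le) auto
  qed
qed

text \<open>Level sets of the gap near its minimum are relatively compact, and the gap is lower
  semicontinuous.\<close>

lemma well_separated:
  assumes "r > 0"
  obtains s where "s > 0" "\<And>\<theta>. \<theta> \<in> \<Theta> \<Longrightarrow> gap \<theta> \<le> ennreal (v + s) \<Longrightarrow> nrm (\<theta> - \<theta>s) \<le> r"
proof (rule ccontr)
  assume *: "\<not> thesis"
  \<comment> \<open>If no separation constant worked, each of these would fail: the bound by
    \<open>\<tau>\<close> keeps the counterexamples in the bounded level set, and
    \<open>1 / real (Suc k)\<close> drives their gap down to \<open>v\<close>.\<close>
  have "\<exists>\<theta>. \<theta> \<in> \<Theta> \<and> gap \<theta> \<le> ennreal (v + min \<tau> (1 / real (Suc k))) \<and> nrm (\<theta> - \<theta>s) > r" for k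
  proof (rule ccontr)
    assume neg: "\<not> ?thesis"
    show False
      by (rule notE[OF * that[of "min \<tau> (1 / real (Suc k))"]]) (use neg tau_pos not_le in auto)
  qed
  then obtain \<theta>k where \<theta>k: "\<And>k. \<theta>k k \<in> \<Theta>" "\<And>k. gap (\<theta>k k) \<le> ennreal (v + min \<tau> (1 / real (Suc k)))"
      "\<And>k. nrm (\<theta>k k - \<theta>s) > r" by metis
  obtain B where B: "\<forall>\<theta>\<in>approx_minimizers \<Theta> \<mu> \<mu>s \<tau>. nrm \<theta> \<le> B" using bounded_level_set by blast
  have "nrm (\<theta>k k) \<le> B" for k
  proof -
    have "PW \<mu>s (\<mu> (\<theta>k k)) \<le> ennreal (v + \<tau>)"
      unfolding PW_eq_gap(1)[OF \<theta>k(1)] using \<theta>k(2)[of k] by (rule order_trans) (simp add: ennreal_leI)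
    also have "\<dots> = PW \<mu>s (\<mu> \<theta>s) + ennreal \<tau>"
      using v_nonneg tau_pos by (simp add: PW_eq_gap(1)[OF theta_in_Theta] gap_theta)
    also have "\<dots> \<le> (INF \<theta>'\<in>\<Theta>. PW \<mu>s (\<mu> \<theta>')) + ennreal \<tau>"
      by (intro add_right_mono INF_greatest theta_min)
    finally show ?thesis using B \<theta>k(1) by (auto simp: approx_minimizers_def)
  qed
  then have in_ball: "\<theta>k k \<in> {x. nrm (x - 0) \<le> B} \<inter> \<Theta>" for k using \<theta>k(1) by simp
  have "compact ({x. nrm (x - 0) \<le> B} \<inter> \<Theta>)"
    by (intro compact_Int_closed compact_is_norm_cball is_norm closed_Theta)
  then obtain l \<sigma> where l: "l \<in> \<Theta>" "strict_mono \<sigma>" "(\<theta>k \<circ> \<sigma>) \<longlonglongrightarrow> l"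
    using in_ball unfolding compact_def by (metis (no_types, lifting) Int_iff)
  then have lim: "(\<lambda>k. nrm (\<theta>k (\<sigma> k) - l)) \<longlonglongrightarrow> 0"
    using is_norm_tendsto[OF is_norm l(3)] by (simp add: comp_def)
  then have "weakly_converges (\<lambda>k. \<mu> (\<theta>k (\<sigma> k))) (\<mu> l)"
    by (intro weak_continuity \<theta>k l)
  then have "gap l \<le> liminf (\<lambda>k. gap (\<theta>k (\<sigma> k)))"
    unfolding gap_def using l(1) \<theta>k(1) by (intro L_norm_proj_cdf_le_liminf model measurable_Fs)
  also have "\<dots> \<le> liminf (\<lambda>k. ennreal (v + 1 / real (Suc k)))"
  proof (intro Liminf_mono always_eventually allI)
    fix k
    have "gap (\<theta>k (\<sigma> k)) \<le> ennreal (v + min \<tau> (1 / real (Suc (\<sigma> k))))" by (rule \<theta>k(2))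
    also have "\<dots> \<le> ennreal (v + 1 / real (Suc k))"
      using strict_mono_imp_increasing[OF l(2), of k]
      by (intro ennreal_leI add_left_mono min.coboundedI2) (simp add: frac_le)
    finally show "gap (\<theta>k (\<sigma> k)) \<le> \<dots>" .
  qed
  also have "\<dots> = ennreal v"
  proof (rule lim_imp_Liminf)
    have "(\<lambda>k. v + 1 / real (Suc k)) \<longlonglongrightarrow> v + 0"
      by (intro tendsto_add tendsto_const) (rule LIMSEQ_Suc[OF lim_const_over_n])
    then show "(\<lambda>k. ennreal (v + 1 / real (Suc k))) \<longlonglongrightarrow> ennreal v"
      by (intro tendsto_ennrealI) simp
  qed simp
  \<comment> \<open>Lower semicontinuity makes the subsequential limit a minimizer, so it is the
    unique one; but all counterexamples stay farther than \<open>r\<close> from it.\<close>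
  finally have "l = \<theta>s"
    using theta_unique[OF l(1)] theta_min[OF l(1)] PW_eq_gap(1)[OF l(1)] PW_eq_gap(1)[OF theta_in_Theta]
    by (simp add: gap_theta antisym)
  with lim have "\<forall>\<^sub>F k in sequentially. nrm (\<theta>k (\<sigma> k) - \<theta>s) < r"
    using order_tendstoD(2) assms by blast
  then show False using \<theta>k(3) eventually_happens'[OF sequentially_bot] by (metis less_asym)
qed

section \<open>Estimates for one perturbed objective at a fixed sample size\<close>

lemma obj_theta: "obj n x \<theta>s = L_norm x" by (simp add: obj_def)

text \<open>Both \<open>Gn\<close> and \<open>Gns\<close> have the form of \<open>x\<close>: the
  deterministic drift plus a perturbation \<open>z\<close> of norm at most \<open>K\<close>, namely
  the empirical process or its limit.\<close>

context
  fixes n :: nat and x z :: "'a \<Rightarrow> real \<Rightarrow> real" and K :: real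
  assumes z: "sphere_measurable z" "L_norm z \<le> ennreal K" and K: "K \<ge> 0"
    and x: "x = (\<lambda>u t. z u t + sqrt (real n) * (Fs u t - F \<theta>s u t))"
begin

lemma obj_theta_le: "obj n x \<theta>s \<le> ennreal (K + sqrt (real n) * v)"
proof -
  have "obj n x \<theta>s \<le> L_norm z + L_norm (\<lambda>u t. sqrt (real n) * (Fs u t - F \<theta>s u t))"
    unfolding obj_theta by (rule L_norm_triangle_via) (simp_all add: x z measurable_simps)
  also have "\<dots> = L_norm z + ennreal (sqrt (real n) * v)"
    by (subst L_norm_mult) (simp_all add: measurable_simps gap_theta[unfolded gap_def] ennreal_mult v_nonneg)
  also have "\<dots> \<le> ennreal (K + sqrt (real n) * v)"
    using z(2) K v_nonneg by (simp add: add_right_mono)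
  finally show ?thesis .
qed

text \<open>The scaled difference of \<open>Fs\<close> and \<open>F \<theta>\<close> is the function
  measured by \<open>obj\<close>, minus \<open>z\<close>, minus the scaled linearization
  remainder.\<close>

lemma sqrt_gap_le:
  assumes "\<theta> \<in> \<Theta>"
  shows "ennreal (sqrt (real n)) * gap \<theta> \<le> obj n x \<theta> + (ennreal K + ennreal (sqrt (real n)) * lin \<theta>)"
proof -
  have D: "sphere_measurable (\<lambda>u t. (\<theta> - \<theta>s) \<bullet> D u t)" by (simp add: measurable_simps)
  have m: "sphere_measurable (F \<theta>)" using assms by (simp add: measurable_simps)
  have "ennreal (sqrt (real n)) * gap \<theta> = L_norm (\<lambda>u t. sqrt (real n) * (Fs u t - F \<theta> u t))"
    unfolding gap_def using m by (subst L_norm_mult) (simp_all add: measurable_simps)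
  also have "\<dots> \<le> obj n x \<theta> + L_norm (\<lambda>u t. (- 1) * z u t
      + (- sqrt (real n)) * (F \<theta> u t - F \<theta>s u t - (\<theta> - \<theta>s) \<bullet> D u t))"
    unfolding obj_def x
    by (rule L_norm_triangle_via; (intro measurable_simps m z D)?) (simp add: algebra_simps)
  also have "\<dots> \<le> obj n x \<theta> + (L_norm (\<lambda>u t. (- 1) * z u t)
      + L_norm (\<lambda>u t. (- sqrt (real n)) * (F \<theta> u t - F \<theta>s u t - (\<theta> - \<theta>s) \<bullet> D u t)))"
    by (intro add_left_mono L_norm_triangle measurable_simps m z D)
  also have "\<dots> = obj n x \<theta> + (L_norm z + ennreal (sqrt (real n)) * lin \<theta>)"
    by (subst (1 2) L_norm_mult, (intro measurable_simps m z D)+) (simp add: linearization_error_def)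
  also have "\<dots> \<le> obj n x \<theta> + (ennreal K + ennreal (sqrt (real n)) * lin \<theta>)"
    by (intro add_left_mono add_right_mono z)
  finally show ?thesis .
qed

text \<open>The gap grows with slope \<open>c\<close>, while on \<open>N1\<close> the linearization
  error has slope at most \<open>c / 2\<close>. The remaining slope \<open>c / 2\<close>, times the
  scaled distance, has to be paid for by \<open>2 * K + b\<close>.\<close>

lemma near_minimizers_confined:
  assumes "\<theta> \<in> N1" "obj n x \<theta> \<le> obj n x \<theta>s + ennreal b" "b \<ge> 0"
  shows "sqrt (real n) * nrm (\<theta> - \<theta>s) \<le> (4 * K + 2 * b) / c"
proof -
  define d where "d = nrm (\<theta> - \<theta>s)"
  have d: "d \<ge> 0" by (simp add: d_def nrm(1))
  have \<theta>: "\<theta> \<in> N" "\<theta> \<in> \<Theta>" using assms(1) N1_subset N_subset by auto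
  have "ennreal (sqrt (real n) * (v + c * d)) = ennreal (sqrt (real n)) * ennreal (v + c * d)"
    using d v_nonneg c_pos by (intro ennreal_mult) auto
  also have "\<dots> \<le> ennreal (sqrt (real n)) * gap \<theta>"
    unfolding d_def by (intro mult_left_mono gap_growth \<theta>) simp
  also have "\<dots> \<le> obj n x \<theta> + (ennreal K + ennreal (sqrt (real n)) * lin \<theta>)"
    by (rule sqrt_gap_le) fact
  also have "\<dots> \<le> (ennreal (K + sqrt (real n) * v) + ennreal b)
      + (ennreal K + ennreal (sqrt (real n)) * ennreal (c / 2 * d))"
    unfolding d_def
    by (intro add_mono mult_left_mono lin_N1 assms order_refl
        order_trans[OF assms(2) add_right_mono[OF obj_theta_le]]) simp
  also have "ennreal (sqrt (real n)) * ennreal (c / 2 * d) = ennreal (sqrt (real n) * (c / 2 * d))"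
    using d c_pos by (intro ennreal_mult[symmetric]) auto
  also have "ennreal (K + sqrt (real n) * v) + ennreal b + (ennreal K + ennreal (sqrt (real n) * (c / 2 * d)))
      = ennreal ((K + sqrt (real n) * v + b) + (K + sqrt (real n) * (c / 2 * d)))"
    using K d v_nonneg c_pos assms(3) by (simp flip: ennreal_plus)
  finally have "sqrt (real n) * (v + c * d) \<le> (K + sqrt (real n) * v + b) + (K + sqrt (real n) * (c / 2 * d))"
    using K d v_nonneg c_pos assms(3) by (subst (asm) ennreal_le_iff) auto
  then have "(sqrt (real n) * d) * c \<le> 4 * K + 2 * b" by (simp add: algebra_simps)
  then show ?thesis using c_pos by (simp add: d_def pos_le_divide_eq)
qed

lemma INF_obj_le: "(INF \<theta>\<in>N1. obj n x \<theta>) \<le> obj n x \<theta>s"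
  by (rule INF_lower) (rule theta_in_N1)

text \<open>Near minimizers stay in a compact ball around \<open>\<theta>s\<close>, on which the objective is lower
  semicontinuous.\<close>

lemma minimizer_exists:
  assumes n: "n > 0" and r: "\<And>\<theta>. nrm (\<theta> - \<theta>s) \<le> r \<Longrightarrow> \<theta> \<in> N1" "(4 * K + 2) / c \<le> sqrt (real n) * r"
  shows "\<exists>\<theta>\<in>N1. obj n x \<theta> \<le> (INF \<theta>\<in>N1. obj n x \<theta>)"
proof -
  define m where "m = (INF \<theta>\<in>N1. obj n x \<theta>)"
  have m_le: "m \<le> obj n x \<theta>s" unfolding m_def by (rule INF_obj_le)
  have "m \<noteq> top"
    using order_trans[OF m_le obj_theta_le] by (auto simp: top_unique)
  then have less: "m < m + ennreal (1 / real (Suc k))" for k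
    by (simp add: ennreal_add_less_top less_top)
  have "\<exists>\<theta>\<in>N1. obj n x \<theta> < m + ennreal (1 / real (Suc k))" for k
    using less[of k] unfolding m_def INF_less_iff by blast
  then obtain \<theta>k where \<theta>k: "\<And>k. \<theta>k k \<in> N1" "\<And>k. obj n x (\<theta>k k) < m + ennreal (1 / real (Suc k))"
    by metis
  have "nrm (\<theta>k k - \<theta>s) \<le> r" for k
  proof -
    \<comment> \<open>The slack is at most 1 for every \<open>k\<close>, so confinement with
      \<open>b = 1\<close> yields the constant \<open>4 * K + 2\<close> of the hypothesis on
      \<open>r\<close>.\<close>
    have "m + ennreal (1 / real (Suc k)) \<le> obj n x \<theta>s + ennreal 1"
      by (intro add_mono m_le ennreal_leI) simp
    then have "sqrt (real n) * nrm (\<theta>k k - \<theta>s) \<le> (4 * K + 2 * 1) / c"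
      using \<theta>k(2)[of k] by (intro near_minimizers_confined \<theta>k(1)) auto
    then have "sqrt (real n) * nrm (\<theta>k k - \<theta>s) \<le> sqrt (real n) * r" using r(2) by simp
    then show ?thesis using n by simp
  qed
  then obtain l \<sigma> where l: "nrm (l - \<theta>s) \<le> r" "strict_mono \<sigma>" "(\<theta>k \<circ> \<sigma>) \<longlonglongrightarrow> l"
    using compact_is_norm_cball[OF is_norm, of \<theta>s r] unfolding compact_def
    by (metis (no_types, lifting) mem_Collect_eq)
  have "obj n x l \<le> liminf (\<lambda>k. obj n x (\<theta>k (\<sigma> k)))"
    unfolding obj_def
  proof (rule L_norm_le_liminf)
    show "sphere_measurable (\<lambda>u t. x u t - sqrt (real n) * ((\<theta>k (\<sigma> k) - \<theta>s) \<bullet> D u t))" for k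
      unfolding x by (intro measurable_simps z)
    show "AE t in lebesgue. (\<lambda>k. x u t - sqrt (real n) * ((\<theta>k (\<sigma> k) - \<theta>s) \<bullet> D u t))
        \<longlonglongrightarrow> x u t - sqrt (real n) * ((l - \<theta>s) \<bullet> D u t)" for u
      using l(3) unfolding comp_def by (intro AE_I2 tendsto_intros)
  qed
  also have "\<dots> \<le> liminf (\<lambda>k. m + ennreal (1 / real (Suc k)))"
  proof (intro Liminf_mono always_eventually allI)
    fix k
    have "obj n x (\<theta>k (\<sigma> k)) \<le> m + ennreal (1 / real (Suc (\<sigma> k)))" using \<theta>k(2) by (rule less_imp_le)
    also have "\<dots> \<le> m + ennreal (1 / real (Suc k))"
      using strict_mono_imp_increasing[OF l(2), of k]
      by (intro add_left_mono ennreal_leI) (simp add: frac_le)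
    finally show "obj n x (\<theta>k (\<sigma> k)) \<le> \<dots>" .
  qed
  also have "\<dots> = m"
  proof (rule lim_imp_Liminf)
    have "(\<lambda>k. m + ennreal (1 / real (Suc k))) \<longlonglongrightarrow> m + ennreal 0"
      by (intro tendsto_add tendsto_const tendsto_ennrealI) (rule LIMSEQ_Suc[OF lim_const_over_n])
    then show "(\<lambda>k. m + ennreal (1 / real (Suc k))) \<longlonglongrightarrow> m" by simp
  qed simp
  \<comment> \<open>The limit remains in the closed ball, and the whole ball lies in
    \<open>N1\<close>.\<close>
  finally show ?thesis using r(1)[OF l(1)] unfolding m_def by blast
qed

text \<open>At distance \<open>O(1 / sqrt n)\<close> of \<open>\<theta>s\<close> the linearization error is \<open>o(1 / sqrt n)\<close>, so
  the scaled objective and its linearization differ by \<open>o(1)\<close>.\<close>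

lemma linearized_objective:
  assumes y: "sphere_measurable y" and x_y: "x = (\<lambda>u t. sqrt (real n) * (y u t - F \<theta>s u t))"
    and "\<theta> \<in> \<Theta>"
  shows "obj n x \<theta> \<le> ennreal (sqrt (real n)) * L_norm (\<lambda>u t. y u t - F \<theta> u t) + ennreal (sqrt (real n)) * lin \<theta>"
    and "ennreal (sqrt (real n)) * L_norm (\<lambda>u t. y u t - F \<theta> u t) \<le> obj n x \<theta> + ennreal (sqrt (real n)) * lin \<theta>"
proof -
  have D: "sphere_measurable (\<lambda>u t. (\<theta> - \<theta>s) \<bullet> D u t)" by (simp add: measurable_simps)
  have m: "sphere_measurable (F \<theta>)" using assms by (simp add: measurable_simps)
  have 1: "ennreal (sqrt (real n)) * L_norm (\<lambda>u t. y u t - F \<theta> u t) = L_norm (\<lambda>u t. sqrt (real n) * (y u t - F \<theta> u t))"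
    by (subst L_norm_mult, (intro measurable_simps m y)+) simp
  have 2: "ennreal (sqrt (real n)) * lin \<theta>
      = L_norm (\<lambda>u t. sqrt (real n) * (F \<theta> u t - F \<theta>s u t - (\<theta> - \<theta>s) \<bullet> D u t))"
    unfolding linearization_error_def by (subst L_norm_mult, (intro measurable_simps m y D)+) simp
  have 3: "ennreal (sqrt (real n)) * lin \<theta>
      = L_norm (\<lambda>u t. (- sqrt (real n)) * (F \<theta> u t - F \<theta>s u t - (\<theta> - \<theta>s) \<bullet> D u t))"
    unfolding linearization_error_def by (subst L_norm_mult, (intro measurable_simps m y D)+) simp
  show "obj n x \<theta> \<le> ennreal (sqrt (real n)) * L_norm (\<lambda>u t. y u t - F \<theta> u t) + ennreal (sqrt (real n)) * lin \<theta>"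
    unfolding 1 2 obj_def x_y
    by (rule L_norm_triangle_via; (intro measurable_simps m y D)?) (simp add: algebra_simps)
  show "ennreal (sqrt (real n)) * L_norm (\<lambda>u t. y u t - F \<theta> u t) \<le> obj n x \<theta> + ennreal (sqrt (real n)) * lin \<theta>"
    unfolding 1 3 obj_def x_y
    by (rule L_norm_triangle_via; (intro measurable_simps m y D)?) (simp add: algebra_simps)
qed

text \<open>Two localizations precede the comparison: \<open>s\<close> separates the minimizer and
  brings \<open>\<theta>\<close> within \<open>r\<close> of \<open>\<theta>s\<close>, then linear
  growth improves this to distance \<open>R / sqrt n\<close>. At that scale the linearization costs
  \<open>e / 2\<close> for each of the two parameters compared, and the tolerance
  \<open>\<eta>\<close> costs at most \<open>e\<close>.\<close>

lemma approx_minimizer_optimal: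
  assumes n: "n > 0" and y: "sphere_measurable y" and z_y: "z = (\<lambda>u t. sqrt (real n) * (y u t - Fs u t))"
    and e: "e > 0" and \<eta>: "0 \<le> \<eta>" "\<eta> \<le> e"
    and R: "R > 0" "(4 * K + e) / c \<le> R"
    and r: "\<And>\<theta>. nrm (\<theta> - \<theta>s) \<le> r \<Longrightarrow> \<theta> \<in> N1"
      "\<And>\<theta>. nrm (\<theta> - \<theta>s) \<le> r \<Longrightarrow> lin \<theta> \<le> ennreal (e / (2 * R) * nrm (\<theta> - \<theta>s))"
    and s: "\<And>\<theta>. \<theta> \<in> \<Theta> \<Longrightarrow> gap \<theta> \<le> ennreal (v + s) \<Longrightarrow> nrm (\<theta> - \<theta>s) \<le> r"
    and large: "R \<le> sqrt (real n) * r" "2 * K + e \<le> sqrt (real n) * s"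
    and \<theta>: "\<theta> \<in> \<Theta>"
      "\<And>\<theta>'. \<theta>' \<in> \<Theta> \<Longrightarrow> L_norm (\<lambda>u t. y u t - F \<theta> u t)
          \<le> L_norm (\<lambda>u t. y u t - F \<theta>' u t) + ennreal (\<eta> / sqrt (real n))"
  shows "\<theta> \<in> N1" "\<And>\<theta>'. \<theta>' \<in> N1 \<Longrightarrow> obj n x \<theta> \<le> obj n x \<theta>' + ennreal (2 * e)"
proof -
  define q where "q = sqrt (real n)"
  have q: "q > 0" using n by (simp add: q_def)
  have m: "sphere_measurable (F \<theta>)" using \<theta>(1) by (simp add: measurable_simps)
  have x_y: "x = (\<lambda>u t. sqrt (real n) * (y u t - F \<theta>s u t))"
    unfolding x z_y by (simp add: algebra_simps)
  have q_\<eta>: "ennreal q * ennreal (\<eta> / sqrt (real n)) = ennreal \<eta>"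
    using q \<eta> by (simp add: q_def flip: ennreal_mult)
  have approx: "ennreal q * L_norm (\<lambda>u t. y u t - F \<theta> u t)
      \<le> ennreal q * L_norm (\<lambda>u t. y u t - F \<theta>' u t) + ennreal \<eta>" if "\<theta>' \<in> \<Theta>" for \<theta>'
    using mult_left_mono[OF \<theta>(2)[OF that], of "ennreal q"] by (simp add: distrib_left q_\<eta>)
  \<comment> \<open>Pass from \<open>Fs\<close> to the data function \<open>y\<close> at cost
    \<open>K\<close>, then compare \<open>\<theta>\<close> with \<open>\<theta>s\<close> by
    approximate minimality.\<close>
  have "ennreal q * gap \<theta> = L_norm (\<lambda>u t. q * (Fs u t - F \<theta> u t))"
    unfolding gap_def by (subst L_norm_mult, (intro measurable_simps m)+) (use q in simp)
  also have "\<dots> \<le> L_norm (\<lambda>u t. (-1) * z u t) + L_norm (\<lambda>u t. q * (y u t - F \<theta> u t))"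
    by (rule L_norm_triangle_via; (intro measurable_simps m y z)?) (simp add: z_y q_def algebra_simps)
  also have "\<dots> = L_norm z + ennreal q * L_norm (\<lambda>u t. y u t - F \<theta> u t)"
    by (subst (1 2) L_norm_mult, (intro measurable_simps m y z)+) (use q in simp)
  also have "\<dots> \<le> ennreal K + (ennreal q * L_norm (\<lambda>u t. y u t - F \<theta>s u t) + ennreal \<eta>)"
    by (intro add_mono z approx theta_in_Theta)
  also have "ennreal q * L_norm (\<lambda>u t. y u t - F \<theta>s u t) = obj n x \<theta>s"
    unfolding obj_theta x_y q_def by (subst L_norm_mult, (intro measurable_simps m y)+) simp
  also have "ennreal K + (obj n x \<theta>s + ennreal \<eta>) \<le> ennreal K + (ennreal (K + q * v) + ennreal e)"
    unfolding q_def by (intro add_mono obj_theta_le order_refl ennreal_leI \<eta>)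
  also have "\<dots> = ennreal (2 * K + q * v + e)"
    using K q v_nonneg e by (simp add: flip: ennreal_plus)
  finally have q_gap: "ennreal q * gap \<theta> \<le> ennreal (2 * K + q * v + e)" .

  \<comment> \<open>For large \<open>n\<close> the excess \<open>2 * K + e\<close> is absorbed by
    \<open>q * s\<close>, so dividing by \<open>q\<close> puts \<open>\<theta>\<close> into the
    separated level set.\<close>
  have "ennreal q * gap \<theta> \<le> ennreal (q * (v + s))"
    by (rule order_trans[OF q_gap]) (use large in \<open>simp add: q_def algebra_simps ennreal_leI\<close>)
  also have "\<dots> = ennreal q * ennreal (v + s)"
    using q by (simp add: ennreal_mult')
  finally have "gap \<theta> \<le> ennreal (v + s)"
    using q by (subst (asm) ennreal_mult_le_mult_iff) auto
  then have near: "nrm (\<theta> - \<theta>s) \<le> r" by (rule s[OF \<theta>(1)])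
  then show N1: "\<theta> \<in> N1" by (rule r)
  define d where "d = nrm (\<theta> - \<theta>s)"
  have d: "d \<ge> 0" by (simp add: d_def nrm(1))
  have "ennreal (q * (v + c * d)) = ennreal q * ennreal (v + c * d)"
    using q by (simp add: ennreal_mult')
  also have "\<dots> \<le> ennreal q * gap \<theta>"
    unfolding d_def using N1 N1_subset by (intro mult_left_mono gap_growth) auto
  also note q_gap
  finally have "q * (v + c * d) \<le> 2 * K + q * v + e"
    using K q v_nonneg e by (subst (asm) ennreal_le_iff) auto
  \<comment> \<open>The inequality gives \<open>2 * K + e\<close>; the weaker bound is used so that
    the same \<open>R\<close> also covers competitors confined by \<open>4 * K / c\<close>.\<close>
  then have "(q * d) * c \<le> 4 * K + e" using K by (simp add: algebra_simps)
  then have qd: "q * d \<le> R" using R(2) c_pos by (meson order_trans pos_le_divide_eq)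

  \<comment> \<open>The slope \<open>e / (2 * R)\<close> is chosen so that scaled distance
    \<open>R\<close> produces scaled error \<open>e / 2\<close>.\<close>
  have q_lin: "ennreal q * lin \<theta>' \<le> ennreal (e / 2)" if "q * nrm (\<theta>' - \<theta>s) \<le> R" for \<theta>'
  proof -
    have "q * nrm (\<theta>' - \<theta>s) \<le> q * r" using that large(1) by (simp add: q_def)
    then have "nrm (\<theta>' - \<theta>s) \<le> r" using q by simp
    then have "ennreal q * lin \<theta>' \<le> ennreal q * ennreal (e / (2 * R) * nrm (\<theta>' - \<theta>s))"
      by (intro mult_left_mono r) auto
    also have "\<dots> = ennreal (e / (2 * R) * (q * nrm (\<theta>' - \<theta>s)))"
      using q by (simp add: ennreal_mult'[symmetric] mult_ac)
    also have "\<dots> \<le> ennreal (e / (2 * R) * R)"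
      using that R(1) e by (intro ennreal_leI mult_left_mono) auto
    also have "e / (2 * R) * R = e / 2" using R(1) by simp
    finally show ?thesis .
  qed
  \<comment> \<open>From the linearized objective to the true distance, across by approximate
    minimality, and back at \<open>\<theta>'\<close>: the total is
    \<open>e / 2 + e + e / 2\<close>.\<close>
  have main: "obj n x \<theta> \<le> obj n x \<theta>' + ennreal (2 * e)" if "\<theta>' \<in> N1" "q * nrm (\<theta>' - \<theta>s) \<le> R" for \<theta>'
  proof -
    have \<theta>': "\<theta>' \<in> \<Theta>" using that N1_subset N_subset by auto
    have "obj n x \<theta> \<le> ennreal q * L_norm (\<lambda>u t. y u t - F \<theta> u t) + ennreal q * lin \<theta>"
      unfolding q_def by (rule linearized_objective[OF y x_y \<theta>(1)])
    also have "\<dots> \<le> (ennreal q * L_norm (\<lambda>u t. y u t - F \<theta>' u t) + ennreal \<eta>) + ennreal (e / 2)"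
      using qd by (intro add_mono approx \<theta>' q_lin) (simp add: d_def)
    also have "\<dots> \<le> ((obj n x \<theta>' + ennreal q * lin \<theta>') + ennreal e) + ennreal (e / 2)"
      unfolding q_def by (intro add_mono linearized_objective[OF y x_y \<theta>'] order_refl ennreal_leI \<eta>)
    also have "\<dots> \<le> ((obj n x \<theta>' + ennreal (e / 2)) + ennreal e) + ennreal (e / 2)"
      by (intro add_mono q_lin that order_refl)
    also have "\<dots> = obj n x \<theta>' + (ennreal (e / 2) + ennreal e + ennreal (e / 2))"
      by (simp add: add.assoc)
    also have "ennreal (e / 2) + ennreal e + ennreal (e / 2) = ennreal (2 * e)"
      using e by (simp flip: ennreal_plus)
    finally show ?thesis .
  qed
  \<comment> \<open>A competitor at least as good as \<open>\<theta>s\<close> is confined to scaled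
    distance \<open>R\<close>. Any other one, however distant, is worse than
    \<open>\<theta>s\<close>, and comparison with \<open>\<theta>s\<close> suffices.\<close>
  show "obj n x \<theta> \<le> obj n x \<theta>' + ennreal (2 * e)" if \<theta>': "\<theta>' \<in> N1" for \<theta>'
  proof (cases "obj n x \<theta>' \<le> obj n x \<theta>s")
    case True
    then have "q * nrm (\<theta>' - \<theta>s) \<le> (4 * K + 2 * 0) / c"
      unfolding q_def using \<theta>' by (intro near_minimizers_confined) auto
    also have "\<dots> \<le> (4 * K + e) / c" using c_pos e by (simp add: divide_right_mono)
    finally show ?thesis using R(2) \<theta>' by (intro main) auto
  next
    case False
    have "obj n x \<theta> \<le> obj n x \<theta>s + ennreal (2 * e)"
      using R(1) by (intro main theta_in_N1) simp
    also have "\<dots> \<le> obj n x \<theta>' + ennreal (2 * e)" using False by (intro add_right_mono) simp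
    finally show ?thesis .
  qed
qed

end

section \<open>Conclusions for \<open>K_set\<close>, uniform over samples once \<open>n\<close> is
  large\<close>

lemma K_set_eq: "K_set N1 \<theta>s D n x \<beta> = {\<theta>\<in>N1. obj n x \<theta> \<le> (INF \<theta>'\<in>N1. obj n x \<theta>') + ennreal \<beta>}"
  unfolding K_set_def obj_def ..

lemma K_set_mono: "a \<le> b \<Longrightarrow> K_set N1 \<theta>s D n x a \<subseteq> K_set N1 \<theta>s D n x b"
  unfolding K_set_eq by (auto elim!: order_trans intro!: add_left_mono ennreal_leI)

lemma K_set_confined:
  assumes "sphere_measurable z" "L_norm z \<le> ennreal K" "K \<ge> 0" "b \<ge> 0"
    and x: "x = (\<lambda>u t. z u t + sqrt (real n) * (Fs u t - F \<theta>s u t))"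
    and \<theta>: "\<theta> \<in> K_set N1 \<theta>s D n x b"
  shows "sqrt (real n) * nrm (\<theta> - \<theta>s) \<le> (4 * K + 2 * b) / c"
proof (rule near_minimizers_confined[OF assms(1-3) x _ _ \<open>b \<ge> 0\<close>])
  show "\<theta> \<in> N1" using \<theta> by (simp add: K_set_eq)
  have "obj n x \<theta> \<le> (INF \<theta>'\<in>N1. obj n x \<theta>') + ennreal b" using \<theta> by (simp add: K_set_eq)
  also have "\<dots> \<le> obj n x \<theta>s + ennreal b"
    by (intro add_right_mono INF_lower theta_in_N1)
  finally show "obj n x \<theta> \<le> obj n x \<theta>s + ennreal b" .
qed

lemma eventually_le_sqrt_mult:
  assumes "r > 0"
  shows "\<forall>\<^sub>F n in sequentially. B \<le> sqrt (real n) * r"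
proof -
  have "filterlim (\<lambda>n. sqrt (real n)) at_top sequentially"
    by (rule filterlim_compose[OF sqrt_at_top filterlim_real_sequentially])
  then have "\<forall>\<^sub>F n in sequentially. B / r \<le> sqrt (real n)" by (simp add: filterlim_at_top)
  then show ?thesis by eventually_elim (use assms in \<open>simp add: field_simps\<close>)
qed

lemma measurable_emp_cdf: "n > 0 \<Longrightarrow> sphere_measurable (emp_cdf n X)"
  using sphere_measurable_proj_cdf[OF prob_space_empirical_measure[of n X]]
  by (simp add: proj_cdf_empirical_measure)

text \<open>The radii \<open>R\<close>, \<open>r\<close> and \<open>s\<close> depend on
  \<open>K\<close> and \<open>e\<close> only, so one threshold for \<open>n\<close> serves all
  samples and tolerances; this allows an application pointwise in \<open>\<omega>\<close>.\<close>

lemma eventually_approx_minimizers_subset_K_set: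
  assumes "K \<ge> 0" "e > 0"
  shows "\<forall>\<^sub>F n in sequentially. \<forall>X \<eta>. L_norm (\<lambda>u t. sqrt (real n) * (emp_cdf n X u t - Fs u t)) \<le> ennreal K
      \<and> 0 \<le> \<eta> \<and> \<eta> \<le> e \<longrightarrow>
      approx_minimizers \<Theta> \<mu> (empirical_measure n X) (\<eta> / sqrt (real n))
        \<subseteq> K_set N1 \<theta>s D n (\<lambda>u t. sqrt (real n) * (emp_cdf n X u t - F \<theta>s u t)) (2 * e)"
proof -
  define R where "R = (4 * K + e) / c"
  have R: "R > 0" using assms c_pos by (simp add: R_def)
  obtain r where r: "r > 0" "\<And>\<theta>. nrm (\<theta> - \<theta>s) \<le> r \<Longrightarrow> \<theta> \<in> N1"
      "\<And>\<theta>. nrm (\<theta> - \<theta>s) \<le> r \<Longrightarrow> lin \<theta> \<le> ennreal (e / (2 * R) * nrm (\<theta> - \<theta>s))"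
    using local_linearization[of "e / (2 * R)"] assms R by (metis divide_pos_pos mult_pos_pos zero_less_numeral)
  obtain s where s: "s > 0" "\<And>\<theta>. \<theta> \<in> \<Theta> \<Longrightarrow> gap \<theta> \<le> ennreal (v + s) \<Longrightarrow> nrm (\<theta> - \<theta>s) \<le> r"
    using well_separated[OF r(1)] by blast
  show ?thesis
    using eventually_le_sqrt_mult[OF r(1), of R] eventually_le_sqrt_mult[OF s(1), of "2 * K + e"]
      eventually_gt_at_top[of 0]
  proof (eventually_elim, intro allI impI subsetI, elim conjE)
    fix n :: nat and X \<eta> \<theta>
    let ?y = "emp_cdf n X" and ?x = "\<lambda>u t. sqrt (real n) * (emp_cdf n X u t - F \<theta>s u t)"
    let ?z = "\<lambda>u t. sqrt (real n) * (emp_cdf n X u t - Fs u t)"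
    assume large: "R \<le> sqrt (real n) * r" "2 * K + e \<le> sqrt (real n) * s" and n: "n > 0"
      and z: "L_norm ?z \<le> ennreal K" and \<eta>: "0 \<le> \<eta>" "\<eta> \<le> e"
      and \<theta>: "\<theta> \<in> approx_minimizers \<Theta> \<mu> (empirical_measure n X) (\<eta> / sqrt (real n))"
    have y: "sphere_measurable ?y" by (rule measurable_emp_cdf[OF n])
    have PW: "PW (empirical_measure n X) (\<mu> \<theta>') = L_norm (\<lambda>u t. ?y u t - F \<theta>' u t)"
      if "\<theta>' \<in> \<Theta>" for \<theta>'
      using PW_eq_L_norm[OF prob_space_empirical_measure[OF n] model[OF that]]
      by (simp add: proj_cdf_empirical_measure[OF n])
    have \<theta>_in: "\<theta> \<in> \<Theta>" using \<theta> by (simp add: approx_minimizers_def)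
    have opt: "L_norm (\<lambda>u t. ?y u t - F \<theta> u t)
        \<le> L_norm (\<lambda>u t. ?y u t - F \<theta>' u t) + ennreal (\<eta> / sqrt (real n))" if "\<theta>' \<in> \<Theta>" for \<theta>'
    proof -
      have "PW (empirical_measure n X) (\<mu> \<theta>)
          \<le> (INF \<theta>'\<in>\<Theta>. PW (empirical_measure n X) (\<mu> \<theta>')) + ennreal (\<eta> / sqrt (real n))"
        using \<theta> by (simp add: approx_minimizers_def)
      also have "\<dots> \<le> PW (empirical_measure n X) (\<mu> \<theta>') + ennreal (\<eta> / sqrt (real n))"
        by (intro add_right_mono INF_lower that)
      finally show ?thesis using PW that \<theta>_in by simp
    qed
    have "?x = (\<lambda>u t. ?z u t + sqrt (real n) * (Fs u t - F \<theta>s u t))"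
      by (simp add: algebra_simps)
    note optimal = approx_minimizer_optimal[OF _ z \<open>K \<ge> 0\<close> this n y refl \<open>e > 0\<close> \<eta> R
        eq_refl[OF R_def[symmetric]] r(2,3) s(2) large \<theta>_in opt]
    have "sphere_measurable ?z" by (intro measurable_simps y)
    note optimal = optimal[OF this]
    show "\<theta> \<in> K_set N1 \<theta>s D n ?x (2 * e)"
      unfolding K_set_eq
    proof (intro CollectI conjI)
      show "\<theta> \<in> N1" by (rule optimal(1))
      \<comment> \<open>Moving the tolerance to the left turns the pointwise comparison into a lower
        bound, which passes to the infimum.\<close>
      have "obj n ?x \<theta> - ennreal (2 * e) \<le> (INF \<theta>'\<in>N1. obj n ?x \<theta>')"
        using optimal(2) by (intro INF_greatest) (simp add: ennreal_minus_le_iff add.commute)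
      then show "obj n ?x \<theta> \<le> (INF \<theta>'\<in>N1. obj n ?x \<theta>') + ennreal (2 * e)"
        by (simp add: ennreal_minus_le_iff add.commute)
    qed
  qed
qed

text \<open>Both sets shrink into a ball around \<open>\<theta>s\<close>. The set with tolerance 0
  is nonempty because a minimizer exists; nonemptiness of the other is a premise, met later through
  the approximate minimizers it contains.\<close>

lemma eventually_K_sets_close:
  assumes "K \<ge> 0" "\<epsilon> > 0" and \<beta>: "\<And>n. \<beta> n \<ge> 0" "\<beta> \<longlonglongrightarrow> 0"
  shows "\<forall>\<^sub>F n in sequentially. \<forall>z y. sphere_measurable z \<and> sphere_measurable y \<and>
      L_norm z \<le> ennreal K \<and> L_norm (\<lambda>u t. sqrt (real n) * (y u t - Fs u t)) \<le> ennreal K \<and>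
      K_set N1 \<theta>s D n (\<lambda>u t. sqrt (real n) * (y u t - F \<theta>s u t)) (\<beta> n) \<noteq> {} \<longrightarrow>
      hausdorff_metric (\<lambda>x y. nrm (x - y))
        (K_set N1 \<theta>s D n (\<lambda>u t. z u t + sqrt (real n) * (Fs u t - F \<theta>s u t)) 0)
        (K_set N1 \<theta>s D n (\<lambda>u t. sqrt (real n) * (y u t - F \<theta>s u t)) (\<beta> n)) < ennreal \<epsilon>"
proof -
  obtain r0 where r0: "r0 > 0" "\<And>\<theta>. nrm (\<theta> - \<theta>s) \<le> r0 \<Longrightarrow> \<theta> \<in> N1"
    using local_linearization[of 1] by (metis zero_less_one)
  \<comment> \<open>One third of \<open>\<epsilon>\<close> keeps the diameter bound
    \<open>2 * r\<close> strictly below \<open>\<epsilon>\<close>.\<close>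
  define r where "r = min r0 (\<epsilon> / 3)"
  have r: "r > 0" "\<And>\<theta>. nrm (\<theta> - \<theta>s) \<le> r \<Longrightarrow> \<theta> \<in> N1" "2 * r < \<epsilon>"
    using r0 \<open>\<epsilon> > 0\<close> by (auto simp: r_def)
  \<comment> \<open>With tolerances below 1 the constant \<open>4 * K + 2\<close> confines both
    sets.\<close>
  have "\<forall>\<^sub>F n in sequentially. \<beta> n < 1" using order_tendstoD(2)[OF \<beta>(2)] by simp
  then show ?thesis
    using eventually_le_sqrt_mult[OF r(1), of "(4 * K + 2) / c"] eventually_gt_at_top[of 0]
  proof (eventually_elim, intro allI impI, elim conjE)
    fix n :: nat and z y :: "'a \<Rightarrow> real \<Rightarrow> real"
    let ?x = "\<lambda>u t. z u t + sqrt (real n) * (Fs u t - F \<theta>s u t)"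
    let ?x' = "\<lambda>u t. sqrt (real n) * (y u t - F \<theta>s u t)"
    let ?z' = "\<lambda>u t. sqrt (real n) * (y u t - Fs u t)"
    assume \<beta>n: "\<beta> n < 1" and large: "(4 * K + 2) / c \<le> sqrt (real n) * r" and n: "0 < n"
      and m: "sphere_measurable z" "sphere_measurable y"
      and z: "L_norm z \<le> ennreal K" "L_norm ?z' \<le> ennreal K"
      and ne: "K_set N1 \<theta>s D n ?x' (\<beta> n) \<noteq> {}"
    have m': "sphere_measurable ?z'" by (intro measurable_simps m)
    have x': "?x' = (\<lambda>u t. ?z' u t + sqrt (real n) * (Fs u t - F \<theta>s u t))"
      by (simp add: algebra_simps)
    have in_ball: "nrm (\<theta> - \<theta>s) \<le> r"
      if "sqrt (real n) * nrm (\<theta> - \<theta>s) \<le> (4 * K + 2 * b) / c" "b \<le> 1" for \<theta> b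
    proof -
      have "(4 * K + 2 * b) / c \<le> (4 * K + 2) / c"
        using that(2) c_pos by (simp add: divide_right_mono)
      then have "sqrt (real n) * nrm (\<theta> - \<theta>s) \<le> sqrt (real n) * r" using that(1) large by linarith
      then show ?thesis using n by simp
    qed
    show "hausdorff_metric (\<lambda>x y. nrm (x - y)) (K_set N1 \<theta>s D n ?x 0) (K_set N1 \<theta>s D n ?x' (\<beta> n))
        < ennreal \<epsilon>"
    proof (rule hausdorff_metric_less[OF is_norm _ ne r(3,1)])
      show "K_set N1 \<theta>s D n ?x 0 \<noteq> {}"
        using minimizer_exists[OF m(1) z(1) \<open>K \<ge> 0\<close> refl n r(2) large] by (auto simp: K_set_eq)
      show "nrm (\<theta> - \<theta>s) \<le> r" if "\<theta> \<in> K_set N1 \<theta>s D n ?x 0" for \<theta>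
        by (rule in_ball[OF K_set_confined[OF m(1) z(1) \<open>K \<ge> 0\<close> order_refl refl that]]) simp
      show "nrm (\<theta> - \<theta>s) \<le> r" if "\<theta> \<in> K_set N1 \<theta>s D n ?x' (\<beta> n)" for \<theta>
        using \<beta>n by (intro in_ball[OF K_set_confined[OF m' z(2) \<open>K \<ge> 0\<close> \<beta>(1) x' that]]) simp
    qed
  qed
qed

end

section \<open>From deterministic estimates to inner probabilities\<close>

theorem theorem3p12:
  fixes \<Theta> :: "(real ^ 'p) set"
    and nrm :: "real ^ 'p \<Rightarrow> real"
    and \<mu> :: "real ^ 'p \<Rightarrow> (real ^ 'd) measure"
    and \<mu>s :: "(real ^ 'd) measure"
    and \<theta>s :: "real ^ 'p"
    and P :: "'w measure"
    and X :: "nat \<Rightarrow> 'w \<Rightarrow> real ^ 'd"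
    and \<eta> :: "nat \<Rightarrow> 'w \<Rightarrow> real"
    and \<tau> c :: real
    and D :: "real ^ 'd \<Rightarrow> real \<Rightarrow> real ^ 'p"
    and G :: "'w \<Rightarrow> real ^ 'd \<Rightarrow> real \<Rightarrow> real"
    and N :: "(real ^ 'p) set"
  defines "emp \<equiv> \<lambda>n \<omega>. empirical_measure n (\<lambda>i. X i \<omega>)"
    and "Fhat \<equiv> \<lambda>n \<omega>. emp_cdf n (\<lambda>i. X i \<omega>)"
    and "F \<equiv> \<lambda>\<theta>. proj_cdf (\<mu> \<theta>)"
    and "Fs \<equiv> proj_cdf \<mu>s"
  defines "Mn \<equiv> \<lambda>n \<omega>. approx_minimizers \<Theta> \<mu> (emp n \<omega>) (\<eta> n \<omega> / sqrt (real n))"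
    and "Gn \<equiv> \<lambda>n \<omega> u t. sqrt (real n) * (Fhat n \<omega> u t - F \<theta>s u t)"
    and "Gns \<equiv> \<lambda>n \<omega> u t. G \<omega> u t + sqrt (real n) * (Fs u t - F \<theta>s u t)"
    and "K \<equiv> K_set (N1_set nrm \<mu> \<theta>s D N c) \<theta>s D"
  assumes norm_Theta: "is_norm nrm"
    and Theta_polish: "polish_metric \<Theta> (\<lambda>x y. nrm (x - y))"
    and Theta_sigma_compact: "sigma_compact_metric \<Theta> (\<lambda>x y. nrm (x - y))"
    and model: "\<forall>\<theta>\<in>\<Theta>. prob_space (\<mu> \<theta>) \<and> sets (\<mu> \<theta>) = sets borel"
    and identifiable: "inj_on \<mu> \<Theta>"
    and data_law: "prob_space \<mu>s" "sets \<mu>s = sets borel"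
    and P_prob: "prob_space P"
    and data_indep: "prob_space.indep_vars P (\<lambda>_. borel) X UNIV"
    and data_distr: "\<forall>i. distr P borel (X i) = \<mu>s"
    and eta_rv: "\<forall>n. \<eta> n \<in> borel_measurable P"
    and eta_pos: "\<forall>n. \<forall>\<omega>\<in>space P. \<eta> n \<omega> > 0"
    and eta_lim: "AE \<omega> in P. (\<lambda>n. \<eta> n \<omega>) \<longlonglongrightarrow> 0"
    and Mn_nonempty: "\<forall>n>0. \<forall>\<omega>\<in>space P. Mn n \<omega> \<noteq> {}"
    and theta_interior: "\<theta>s \<in> interior \<Theta>"
    and theta_min: "\<forall>\<theta>\<in>\<Theta>. PW \<mu>s (\<mu> \<theta>s) \<le> PW \<mu>s (\<mu> \<theta>)"
    and theta_unique: "\<forall>\<theta>\<in>\<Theta>. PW \<mu>s (\<mu> \<theta>) = PW \<mu>s (\<mu> \<theta>s) \<longrightarrow> \<theta> = \<theta>s"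
    and A1: "AE \<omega> in P. (\<lambda>n. wasserstein1 (emp n \<omega>) \<mu>s) \<longlonglongrightarrow> 0"
    and A2: "\<forall>\<theta>n \<theta>. (\<forall>n. \<theta>n n \<in> \<Theta>) \<and> \<theta> \<in> \<Theta> \<and> (\<lambda>n. nrm (\<theta>n n - \<theta>)) \<longlonglongrightarrow> 0
               \<longrightarrow> weakly_converges (\<lambda>n. \<mu> (\<theta>n n)) (\<mu> \<theta>)"
    and A3: "\<tau> > 0" "\<exists>B. \<forall>\<theta>\<in>approx_minimizers \<Theta> \<mu> \<mu>s \<tau>. nrm \<theta> \<le> B"
    and A4: "(\<lambda>(u, t). D u t) \<in> borel_measurable (restrict_space borel (sphere 0 1) \<Otimes>\<^sub>M borel)"
            "((\<lambda>\<theta>. linearization_error \<mu> \<theta>s D \<theta> / ennreal (nrm (\<theta> - \<theta>s))) \<longlongrightarrow> 0)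
               (at \<theta>s within \<Theta>)"
    and A5: "random_element_L P G"
            "weakly_converges_L P (\<lambda>n \<omega> u t. sqrt (real n) * (Fhat n \<omega> u t - Fs u t)) G"
    and A6: "N \<subseteq> \<Theta>" "\<exists>U. openin (top_of_set \<Theta>) U \<and> \<theta>s \<in> U \<and> U \<subseteq> N" "c > 0"
            "\<forall>\<theta>\<in>N. PW (\<mu> \<theta>) \<mu>s \<ge> PW (\<mu> \<theta>s) \<mu>s + ennreal (c * nrm (\<theta> - \<theta>s))"
  shows "\<exists>\<beta> :: nat \<Rightarrow> real. (\<forall>n. \<beta> n \<ge> 0) \<and> \<beta> \<longlonglongrightarrow> 0 \<and>
           (\<lambda>n. inner_prob P {\<omega>\<in>space P. Mn n \<omega> \<subseteq> K n (Gn n \<omega>) (\<beta> n)}) \<longlonglongrightarrow> 1 \<and>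
           (\<forall>\<epsilon>>0. (\<lambda>n. inner_prob P {\<omega>\<in>space P.
               hausdorff_metric (\<lambda>x y. nrm (x - y)) (K n (Gns n \<omega>) 0) (K n (Gn n \<omega>) (\<beta> n))
                 < ennreal \<epsilon>}) \<longlonglongrightarrow> 1)"
proof -
  interpret prob_space P by fact
  interpret prw_model \<Theta> nrm \<mu> \<mu>s \<theta>s \<tau> c D N
  proof (rule prw_model.intro)
    show "closed \<Theta>" by (rule closed_if_polish_metric[OF norm_Theta Theta_polish])
    show "prob_space (\<mu> \<theta>)" "sets (\<mu> \<theta>) = sets borel" "PW \<mu>s (\<mu> \<theta>s) \<le> PW \<mu>s (\<mu> \<theta>)"
      if "\<theta> \<in> \<Theta>" for \<theta>
      using that model theta_min by auto
    show "\<theta> = \<theta>s" if "\<theta> \<in> \<Theta>" "PW \<mu>s (\<mu> \<theta>) = PW \<mu>s (\<mu> \<theta>s)" for \<theta>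
      using that theta_unique by blast
    show "weakly_converges (\<lambda>n. \<mu> (\<theta>n n)) (\<mu> \<theta>)"
      if "\<And>n. \<theta>n n \<in> \<Theta>" "\<theta> \<in> \<Theta>" "(\<lambda>n. nrm (\<theta>n n - \<theta>)) \<longlonglongrightarrow> 0" for \<theta>n \<theta>
      using that A2 by blast
    show "PW (\<mu> \<theta>s) \<mu>s + ennreal (c * nrm (\<theta> - \<theta>s)) \<le> PW (\<mu> \<theta>) \<mu>s" if "\<theta> \<in> N" for \<theta>
      using that A6(4) by blast
  qed fact+
  let ?Z = "\<lambda>n \<omega> u t. sqrt (real n) * (Fhat n \<omega> u t - Fs u t)"
  let ?A = "\<lambda>n b. {\<omega>\<in>space P. Mn n \<omega> \<subseteq> K n (Gn n \<omega>) b}"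
  have K_mono: "K n x a \<subseteq> K n x b" if "a \<le> b" for n x a b
    unfolding K_def by (rule K_set_mono[OF that])
  \<comment> \<open>For a fixed tolerance the inclusion holds on the intersection of two events: a
    bounded empirical process and a small \<open>\<eta> n\<close>, each given half of the error
    \<open>d\<close>.\<close>
  have A_lim: "(\<lambda>n. inner_prob P (?A n b)) \<longlonglongrightarrow> 1" if "b > 0" for b
    unfolding inner_prob_tendsto_1_iff
  proof (intro allI impI)
    fix d :: real assume "d > 0"
    then obtain B where B: "B > 0" "\<forall>\<^sub>F n in sequentially.
        inner_prob P {\<omega>\<in>space P. L_norm (?Z n \<omega>) \<le> ennreal B} > 1 - d / 2"
      using weakly_converges_L_tight[OF A5, of "d / 2"] by auto
    have "\<forall>\<^sub>F n in sequentially. inner_prob P {\<omega>\<in>space P. \<eta> n \<omega> < b / 2} > 1 - d / 2"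
      using inner_prob_AE_tendsto_0[of \<eta> "b / 2"] eta_rv eta_lim \<open>b > 0\<close> \<open>d > 0\<close>
      unfolding inner_prob_tendsto_1_iff by simp
    \<comment> \<open>The deterministic inclusion doubles its parameter, so \<open>b / 2\<close>
      yields tolerance \<open>b\<close>.\<close>
    moreover have "\<forall>\<^sub>F n in sequentially. \<forall>X \<eta>. L_norm (\<lambda>u t. sqrt (real n) * (emp_cdf n X u t - Fs u t)) \<le> ennreal B
        \<and> 0 \<le> \<eta> \<and> \<eta> \<le> b / 2 \<longrightarrow>
        approx_minimizers \<Theta> \<mu> (empirical_measure n X) (\<eta> / sqrt (real n))
          \<subseteq> K n (\<lambda>u t. sqrt (real n) * (emp_cdf n X u t - F \<theta>s u t)) b"
      using eventually_approx_minimizers_subset_K_set[of B "b / 2"] B(1) \<open>b > 0\<close>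
      unfolding K_def Fs_def F_def by simp
    ultimately show "\<forall>\<^sub>F n in sequentially. inner_prob P (?A n b) > 1 - d"
      using B(2)
    proof eventually_elim
      case (elim n)
      have "1 - d < inner_prob P ({\<omega>\<in>space P. L_norm (?Z n \<omega>) \<le> ennreal B} \<inter> {\<omega>\<in>space P. \<eta> n \<omega> < b / 2})"
        using inner_prob_Int[OF elim(3,1)] by simp
      also have "\<dots> \<le> inner_prob P (?A n b)"
      proof (rule inner_prob_mono, rule subsetI, elim IntE CollectE conjE, intro CollectI conjI)
        fix \<omega> assume \<omega>: "\<omega> \<in> space P" "L_norm (?Z n \<omega>) \<le> ennreal B" "\<eta> n \<omega> < b / 2"
        have "0 \<le> \<eta> n \<omega>" using eta_pos \<omega>(1) by (intro less_imp_le) blast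
        then show "Mn n \<omega> \<subseteq> K n (Gn n \<omega>) b"
          using elim(2) \<omega>(2) less_imp_le[OF \<omega>(3)] unfolding Mn_def Gn_def Fhat_def emp_def by blast
      qed
      finally show ?case .
    qed
  qed
  \<comment> \<open>Larger tolerances enlarge the event, which gives the monotonicity that the
    diagonal choice requires.\<close>
  obtain \<beta> where \<beta>: "\<And>n. \<beta> n \<ge> 0" "\<beta> \<longlonglongrightarrow> 0" "(\<lambda>n. inner_prob P (?A n (\<beta> n))) \<longlonglongrightarrow> 1"
  proof (rule diagonal_null_sequence[of "\<lambda>n b. inner_prob P (?A n b)"])
    show "inner_prob P (?A n a) \<le> inner_prob P (?A n b)" if "a \<le> b" for n a b
      using K_mono[OF that] by (intro inner_prob_mono) blast
  qed (use A_lim inner_prob_nonneg inner_prob_le_1 in auto)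
  have "(\<lambda>n. inner_prob P {\<omega>\<in>space P.
      hausdorff_metric (\<lambda>x y. nrm (x - y)) (K n (Gns n \<omega>) 0) (K n (Gn n \<omega>) (\<beta> n)) < ennreal \<epsilon>}) \<longlonglongrightarrow> 1"
    if "\<epsilon> > 0" for \<epsilon>
    unfolding inner_prob_tendsto_1_iff
  proof (intro allI impI)
    fix d :: real assume "d > 0"
    then have d: "d / 3 > 0" by simp
    obtain B1 where B1: "B1 > 0" "\<forall>\<^sub>F n in sequentially.
        inner_prob P {\<omega>\<in>space P. L_norm (?Z n \<omega>) \<le> ennreal B1} > 1 - d / 3"
      using weakly_converges_L_tight[OF A5 d] by auto
    obtain B2 where B2: "B2 > 0" "inner_prob P {\<omega>\<in>space P. L_norm (G \<omega>) \<le> ennreal B2} > 1 - d / 3"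
      using random_element_L_tight[OF A5(1) d] by auto
    define B where "B = max B1 B2"
    have B: "B \<ge> 0" "ennreal B1 \<le> ennreal B" "ennreal B2 \<le> ennreal B"
      using B1(1) by (auto simp: B_def intro!: ennreal_leI)
    have "\<forall>\<^sub>F n in sequentially. inner_prob P (?A n (\<beta> n)) > 1 - d / 3"
      using \<beta>(3) d unfolding inner_prob_tendsto_1_iff by blast
    then show "\<forall>\<^sub>F n in sequentially. 1 - d < inner_prob P {\<omega>\<in>space P.
        hausdorff_metric (\<lambda>x y. nrm (x - y)) (K n (Gns n \<omega>) 0) (K n (Gn n \<omega>) (\<beta> n)) < ennreal \<epsilon>}"
      using B1(2) eventually_K_sets_close[OF B(1) that \<beta>(1,2)] eventually_gt_at_top[of 0]
    proof eventually_elim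
      case (elim n)
      \<comment> \<open>Three events share the error: the inclusion of approximate minimizers, the
        bound on the empirical process, and the bound on \<open>G\<close>.\<close>
      have "1 - (d / 3 + (d / 3 + d / 3)) < inner_prob P (?A n (\<beta> n) \<inter>
          ({\<omega>\<in>space P. L_norm (?Z n \<omega>) \<le> ennreal B1} \<inter> {\<omega>\<in>space P. L_norm (G \<omega>) \<le> ennreal B2}))"
        by (intro inner_prob_Int elim B2)
      also have "\<dots> \<le> inner_prob P {\<omega>\<in>space P.
        hausdorff_metric (\<lambda>x y. nrm (x - y)) (K n (Gns n \<omega>) 0) (K n (Gn n \<omega>) (\<beta> n)) < ennreal \<epsilon>}"
      proof (intro inner_prob_mono subsetI CollectI conjI)
        fix \<omega> assume \<omega>: "\<omega> \<in> ?A n (\<beta> n) \<inter>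
          ({\<omega>\<in>space P. L_norm (?Z n \<omega>) \<le> ennreal B1} \<inter> {\<omega>\<in>space P. L_norm (G \<omega>) \<le> ennreal B2})"
        then show sp: "\<omega> \<in> space P" by simp
        \<comment> \<open>On this event the set contains the nonempty \<open>Mn n \<omega>\<close>;
          this is where the first claim enters the second.\<close>
        have "K n (Gn n \<omega>) (\<beta> n) \<noteq> {}" using \<omega> Mn_nonempty elim(4) by blast
        moreover have "sphere_measurable (G \<omega>)"
          using A5(1) sp by (intro sphere_measurable_L_ambient) (auto simp: random_element_L_def L_space_def)
        moreover have "sphere_measurable (Fhat n \<omega>)"
          unfolding Fhat_def by (rule measurable_emp_cdf[OF elim(4)])
        moreover have "L_norm (?Z n \<omega>) \<le> ennreal B" "L_norm (G \<omega>) \<le> ennreal B"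
          using \<omega> order_trans[OF _ B(2)] order_trans[OF _ B(3)] by auto
        ultimately show "hausdorff_metric (\<lambda>x y. nrm (x - y)) (K n (Gns n \<omega>) 0) (K n (Gn n \<omega>) (\<beta> n))
            < ennreal \<epsilon>"
          using elim(3) unfolding K_def Gns_def Gn_def Fs_def F_def by blast
      qed
      finally show ?case by simp
    qed
  qed
  with \<beta> show ?thesis by (intro exI[of _ \<beta>]) blast
qed

end
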